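(* Let $(M,\Sigma,g_c)$ be a sub-Riemannian manifold and $f:M\to\mathbb{R}$ a smooth function. Then $f$ is n-convex if and only if its horizontal Hessian $\mathrm{Hess}^{\mathcal H}f$ is positive semidefinite (i.e. $\mathrm{Hess}^{\mathcal H}f(v,v)\ge 0$ for every $p\in M$ and every $v\in\Sigma_p$).
   Context: A sub-Riemannian manifold $(M,\Sigma,g_c)$ is a smooth manifold $M$ of dimension $m$ with a smooth (non-integrable) distribution $\Sigma\subset TM$ of rank $k<m$ and a smooth inner product $g_c$ on $\Sigma$. Throughout, $g_c=g|_\Sigma$ for a fixed Riemannian metric $g$ on $M$, $TM=\Sigma\oplus\Sigma^\perp$ is the $g$-orthogonal decomposition, $\mathcal P$ is the projection onto $\Sigma$, and $\nabla$ is the Levi-Civita connection of $g$. The horizontal connection is $D_XY:=\mathcal P(\nabla_XY)$ for $X,Y\in\Gamma(\Sigma)$ (smooth sections of $\Sigma$); it induces differentiation of horizontal vector fields along horizontal curves (curves with $\dot\gamma\in\Sigma_\gamma$). A nonholonomic geodesic is a smooth horizontal curve with $D_{\dot\gamma}\dot\gamma=\mathcal P(\nabla_{\dot\gamma}\dot\gamma)=0$. The horizontal gradient $\nabla^{\mathcal H}f\in\Gamma(\Sigma)$ of a smooth function $f$ is defined by $g_c(X,\nabla^{\mathcal H}f)=Xf$ for all $X\in\Gamma(\Sigma)$. The horizontal Hessian is $$\mathrm{Hess}^{\mathcal H}f(X,Y):=\tfrac12\{g_c(D_X(\nabla^{\mathcal H}f),Y)+g_c(D_Y(\nabla^{\mathcal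 H}f),X)\},\quad X,Y\in\Gamma(\Sigma),$$ which is tensorial in $X,Y$ and hence defined on vectors of $\Sigma_p$. A function $f$ on $M$ is n-convex if $f\circ\gamma$ is convex for every nonholonomic geodesic $\gamma$ in $M$. *)

theory Defs
  imports "HOL-Analysis.Analysis" "HOL-Library.Function_Algebras"
begin

text \<open>Tangent vectors are encoded below as functions (from charts to \<open>\<real>\<^sup>m\<close>), so that the library
  notions \<^const>\<open>subspace\<close>, \<^const>\<open>span\<close> and \<^const>\<open>independent\<close> apply to them once
  function spaces are real vector spaces under the pointwise operations.\<close>

instantiation "fun" :: (type, real_vector) real_vector
begin

definition scaleR_fun :: "real \<Rightarrow> ('a \<Rightarrow> 'b) \<Rightarrow> 'a \<Rightarrow> 'b"
  where "scaleR_fun r f = (\<lambda>x. r *\<^sub>R f x)"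

instance
  by standard (simp_all add: scaleR_fun_def fun_eq_iff scaleR_add_right scaleR_add_left)

end

fun Ck_on :: "nat \<Rightarrow> 'a::real_normed_vector set \<Rightarrow> ('a \<Rightarrow> 'b::real_normed_vector) \<Rightarrow> bool" where
  "Ck_on 0 S f \<longleftrightarrow> continuous_on S f"
| "Ck_on (Suc n) S f \<longleftrightarrow> (\<forall>x\<in>S. f differentiable (at x)) \<and>
     (\<forall>v. Ck_on n S (\<lambda>x. frechet_derivative f (at x) v))"

text \<open>\<open>C\<^sup>\<infinity>\<close>-smoothness on an open set of a finite-dimensional space.\<close>

definition smooth_on :: "'a::real_normed_vector set \<Rightarrow> ('a \<Rightarrow> 'b::real_normed_vector) \<Rightarrow> bool" where
  "smooth_on S f \<longleftrightarrow> (\<forall>n. Ck_on n S f)"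

text \<open>A chart is a pair \<open>(U, \<phi>)\<close>; only the values of \<open>\<phi>\<close> on \<open>U\<close> matter.\<close>

type_synonym ('a, 'm) chart = "'a set \<times> ('a \<Rightarrow> real ^ 'm)"

definition chart_inv :: "('a, 'm::finite) chart \<Rightarrow> real ^ 'm \<Rightarrow> 'a" where
  "chart_inv c = inv_into (fst c) (snd c)"

definition is_chart :: "'a topology \<Rightarrow> ('a, 'm::finite) chart \<Rightarrow> bool" where
  "is_chart M c \<longleftrightarrow> openin M (fst c) \<and> open (snd c ` fst c) \<and>
     homeomorphic_map (subtopology M (fst c)) (top_of_set (snd c ` fst c)) (snd c)"

definition smooth_transition :: "('a, 'm::finite) chart \<Rightarrow> ('a, 'm) chart \<Rightarrow> bool" where
  "smooth_transition c d \<longleftrightarrow> smooth_on (snd c ` (fst c \<inter> fst d)) (snd d \<circ> chart_inv c)"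

text \<open>A tangent vector at \<open>p\<close> is the family of its components with respect to all charts of the
  atlas around \<open>p\<close>, subject to the usual transformation law.  The value at all other (irrelevant)
  charts is normalised to \<open>0\<close>, so that equality of tangent vectors is equality of functions.\<close>

type_synonym ('a, 'm) tvec = "('a, 'm) chart \<Rightarrow> real ^ 'm"
type_synonym ('a, 'm) vfield = "'a \<Rightarrow> ('a, 'm) tvec"

text \<open>The atlas need not be maximal: it only serves to determine the smooth structure.\<close>

locale smooth_manifold =
  fixes M :: "'a topology" and A :: "('a, 'm::finite) chart set"
  assumes Hausdorff: "Hausdorff_space M"
    and second_countable: "second_countable M"
    and charts: "c \<in> A \<Longrightarrow> is_chart M c"
    and cover: "(\<Union>c\<in>A. fst c) = topspace M"
    and transition: "c \<in> A \<Longrightarrow> d \<in> A \<Longrightarrow> smooth_transition c d"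
begin

definition charts_at :: "'a \<Rightarrow> ('a, 'm) chart set" where
  "charts_at p = {c \<in> A. p \<in> fst c}"

text \<open>An arbitrary chart of the atlas around \<open>p\<close>; the notions defined through it below do not depend on
  this choice.\<close>

definition chart_of :: "'a \<Rightarrow> ('a, 'm) chart" where
  "chart_of p = (SOME c. c \<in> charts_at p)"

definition tangent :: "'a \<Rightarrow> ('a, 'm) tvec set" where
  "tangent p = {v.
     (\<forall>c\<in>charts_at p. \<forall>d\<in>charts_at p.
        v d = frechet_derivative (snd d \<circ> chart_inv c) (at (snd c p)) (v c)) \<and>
     (\<forall>c. c \<notin> charts_at p \<longrightarrow> v c = 0)}"

definition smooth_fun :: "'a set \<Rightarrow> ('a \<Rightarrow> 'b::real_normed_vector) \<Rightarrow> bool" where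
  "smooth_fun V h \<longleftrightarrow> (\<forall>c\<in>A. smooth_on (snd c ` (fst c \<inter> V)) (h \<circ> chart_inv c))"

text \<open>The derivative \<open>v h = dh\<^sub>p(v)\<close> of a function along a tangent vector \<open>v\<close> at \<open>p\<close>.\<close>

definition differential :: "('a \<Rightarrow> 'b::real_normed_vector) \<Rightarrow> 'a \<Rightarrow> ('a, 'm) tvec \<Rightarrow> 'b" where
  "differential h p v =
     frechet_derivative (h \<circ> chart_inv (chart_of p)) (at (snd (chart_of p) p)) (v (chart_of p))"

text \<open>Smooth sections of the tangent bundle over an open set \<open>V\<close>; values outside \<open>V\<close> are irrelevant.\<close>

definition smooth_vfield :: "'a set \<Rightarrow> ('a, 'm) vfield \<Rightarrow> bool" where
  "smooth_vfield V Y \<longleftrightarrow> (\<forall>p\<in>V. Y p \<in> tangent p) \<and>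
     (\<forall>c\<in>A. smooth_on (snd c ` (fst c \<inter> V)) (\<lambda>x. Y (chart_inv c x) c))"

text \<open>The coordinate vector field \<open>\<partial>\<^sub>i\<close> of the chart \<open>c\<close>.\<close>

definition coord_field :: "('a, 'm) chart \<Rightarrow> 'm \<Rightarrow> ('a, 'm) vfield" where
  "coord_field c i p = (\<lambda>d. if d \<in> charts_at p
     then frechet_derivative (snd d \<circ> chart_inv c) (at (snd c p)) (axis i 1) else 0)"

definition smooth_curve :: "real set \<Rightarrow> (real \<Rightarrow> 'a) \<Rightarrow> bool" where
  "smooth_curve I \<gamma> \<longleftrightarrow> open I \<and> is_interval I \<and> continuous_map (top_of_set I) M \<gamma> \<and>
     (\<forall>c\<in>A. smooth_on {t\<in>I. \<gamma> t \<in> fst c} (snd c \<circ> \<gamma>))"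

definition velocity :: "(real \<Rightarrow> 'a) \<Rightarrow> real \<Rightarrow> ('a, 'm) tvec" where
  "velocity \<gamma> t = (\<lambda>c. if c \<in> charts_at (\<gamma> t) then vector_derivative (snd c \<circ> \<gamma>) (at t) else 0)"

text \<open>A distribution is integrable if the manifold is foliated by submanifolds tangent to it: around every point
  there is a chart \<open>\<phi>\<close> of the smooth structure (not necessarily in the given atlas) in which the
  distribution consists of the vectors tangent to the translates of a fixed linear subspace.\<close>

definition integrable_distribution :: "('a \<Rightarrow> ('a, 'm) tvec set) \<Rightarrow> bool" where
  "integrable_distribution \<Sigma> \<longleftrightarrow> (\<forall>p\<in>topspace M. \<exists>U (\<phi> :: 'a \<Rightarrow> real ^ 'm) L.
     p \<in> U \<and> is_chart M (U, \<phi>) \<and>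
     (\<forall>c\<in>A. smooth_transition c (U, \<phi>) \<and> smooth_transition (U, \<phi>) c) \<and>
     subspace L \<and> (\<forall>q\<in>U. \<Sigma> q = {v \<in> tangent q. differential \<phi> q v \<in> L}))"

end

locale riemannian_manifold = smooth_manifold M A
  for M :: "'a topology" and A :: "('a, 'm::finite) chart set" +
  fixes g :: "'a \<Rightarrow> ('a, 'm) tvec \<Rightarrow> ('a, 'm) tvec \<Rightarrow> real"
  assumes metric_sym: "p \<in> topspace M \<Longrightarrow> u \<in> tangent p \<Longrightarrow> v \<in> tangent p \<Longrightarrow> g p u v = g p v u"
    and metric_add: "p \<in> topspace M \<Longrightarrow> u \<in> tangent p \<Longrightarrow> v \<in> tangent p \<Longrightarrow> w \<in> tangent p \<Longrightarrow>
      g p (u + v) w = g p u w + g p v w"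
    and metric_scale: "p \<in> topspace M \<Longrightarrow> u \<in> tangent p \<Longrightarrow> v \<in> tangent p \<Longrightarrow>
      g p (r *\<^sub>R u) v = r * g p u v"
    and metric_pos: "p \<in> topspace M \<Longrightarrow> v \<in> tangent p \<Longrightarrow> v \<noteq> 0 \<Longrightarrow> 0 < g p v v"
    and metric_smooth: "openin M V \<Longrightarrow> smooth_vfield V Y \<Longrightarrow> smooth_vfield V Z \<Longrightarrow>
      smooth_fun V (\<lambda>p. g p (Y p) (Z p))"

text \<open>The Levi-Civita connection: the torsion-free metric affine connection.  \<open>nabla p v Y\<close> is
  \<open>\<nabla>\<^sub>v Y\<close> for \<open>v\<close> tangent at \<open>p\<close> and \<open>Y\<close> a smooth vector field on some neighbourhood \<open>V\<close> of \<open>p\<close>;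
  that is, the connection acts on local sections.  Torsion-freeness
  \<open>\<nabla>\<^sub>Y Z - \<nabla>\<^sub>Z Y = [Y, Z]\<close> is stated by applying both sides to smooth functions.\<close>

locale levi_civita_connection = riemannian_manifold M A g
  for M :: "'a topology" and A :: "('a, 'm::finite) chart set" and g +
  fixes nabla :: "'a \<Rightarrow> ('a, 'm) tvec \<Rightarrow> ('a, 'm) vfield \<Rightarrow> ('a, 'm) tvec"
  assumes nabla_local: "openin M V \<Longrightarrow> p \<in> V \<Longrightarrow> v \<in> tangent p \<Longrightarrow>
      smooth_vfield V Y \<Longrightarrow> smooth_vfield V Z \<Longrightarrow> (\<And>q. q \<in> V \<Longrightarrow> Y q = Z q) \<Longrightarrow>
      nabla p v Y = nabla p v Z"
    and nabla_smooth: "openin M V \<Longrightarrow> smooth_vfield V Y \<Longrightarrow> smooth_vfield V Z \<Longrightarrow>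
      smooth_vfield V (\<lambda>p. nabla p (Y p) Z)"
    and nabla_tangent: "openin M V \<Longrightarrow> p \<in> V \<Longrightarrow> v \<in> tangent p \<Longrightarrow> smooth_vfield V Y \<Longrightarrow>
      nabla p v Y \<in> tangent p"
    and nabla_add_left: "openin M V \<Longrightarrow> p \<in> V \<Longrightarrow> u \<in> tangent p \<Longrightarrow> v \<in> tangent p \<Longrightarrow>
      smooth_vfield V Y \<Longrightarrow> nabla p (u + v) Y = nabla p u Y + nabla p v Y"
    and nabla_scale_left: "openin M V \<Longrightarrow> p \<in> V \<Longrightarrow> v \<in> tangent p \<Longrightarrow>
      smooth_vfield V Y \<Longrightarrow> nabla p (r *\<^sub>R v) Y = r *\<^sub>R nabla p v Y"
    and nabla_add_right: "openin M V \<Longrightarrow> p \<in> V \<Longrightarrow> v \<in> tangent p \<Longrightarrow>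
      smooth_vfield V Y \<Longrightarrow> smooth_vfield V Z \<Longrightarrow>
      nabla p v (\<lambda>q. Y q + Z q) = nabla p v Y + nabla p v Z"
    and nabla_Leibniz: "openin M V \<Longrightarrow> p \<in> V \<Longrightarrow> v \<in> tangent p \<Longrightarrow>
      smooth_fun V (h :: 'a \<Rightarrow> real) \<Longrightarrow> smooth_vfield V Y \<Longrightarrow>
      nabla p v (\<lambda>q. h q *\<^sub>R Y q) = differential h p v *\<^sub>R Y p + h p *\<^sub>R nabla p v Y"
    and torsion_free: "openin M V \<Longrightarrow> p \<in> V \<Longrightarrow>
      smooth_fun V (h :: 'a \<Rightarrow> real) \<Longrightarrow> smooth_vfield V Y \<Longrightarrow> smooth_vfield V Z \<Longrightarrow>
      differential h p (nabla p (Y p) Z - nabla p (Z p) Y) =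
        differential (\<lambda>q. differential h q (Z q)) p (Y p) -
        differential (\<lambda>q. differential h q (Y q)) p (Z p)"
    and metric_compatible: "openin M V \<Longrightarrow> p \<in> V \<Longrightarrow> v \<in> tangent p \<Longrightarrow>
      smooth_vfield V Y \<Longrightarrow> smooth_vfield V Z \<Longrightarrow>
      differential (\<lambda>q. g q (Y q) (Z q)) p v = g p (nabla p v Y) (Z p) + g p (Y p) (nabla p v Z)"
begin

text \<open>The covariant derivative along \<open>\<gamma>\<close> of a vector field \<open>Z\<close> along \<open>\<gamma>\<close>: writing
  \<open>Z = \<Sum>\<^sub>i Z\<^sup>i \<partial>\<^sub>i\<close> in a chart, it is \<open>\<Sum>\<^sub>i (Z\<^sup>i)' \<partial>\<^sub>i + Z\<^sup>i \<nabla>\<^bsub>\<gamma>'\<^esub> \<partial>\<^sub>i\<close>.\<close>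

definition nabla_along :: "(real \<Rightarrow> 'a) \<Rightarrow> (real \<Rightarrow> ('a, 'm) tvec) \<Rightarrow> real \<Rightarrow> ('a, 'm) tvec" where
  "nabla_along \<gamma> Z t = (let c = chart_of (\<gamma> t) in
     \<Sum>i\<in>UNIV. deriv (\<lambda>s. Z s c $ i) t *\<^sub>R coord_field c i (\<gamma> t) +
       (Z t c $ i) *\<^sub>R nabla (\<gamma> t) (velocity \<gamma> t) (coord_field c i))"

end

text \<open>The inner product \<open>g\<^sub>c\<close> on \<open>\<Sigma>\<close> is the restriction of \<open>g\<close>.\<close>

locale sub_riemannian_manifold = levi_civita_connection M A g nabla
  for M :: "'a topology" and A :: "('a, 'm::finite) chart set" and g nabla +
  fixes k :: nat and \<Sigma> :: "'a \<Rightarrow> ('a, 'm) tvec set"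
  assumes rank_less: "k < CARD('m)"
    and distribution: "p \<in> topspace M \<Longrightarrow> subspace (\<Sigma> p) \<and> \<Sigma> p \<subseteq> tangent p"
    and local_frame: "p \<in> topspace M \<Longrightarrow> \<exists>V (E :: nat \<Rightarrow> ('a, 'm) vfield).
      openin M V \<and> p \<in> V \<and> (\<forall>i<k. smooth_vfield V (E i)) \<and>
      (\<forall>q\<in>V. inj_on (\<lambda>i. E i q) {..<k} \<and> independent ((\<lambda>i. E i q) ` {..<k}) \<and>
         span ((\<lambda>i. E i q) ` {..<k}) = \<Sigma> q)"
    and non_integrable: "\<not> integrable_distribution \<Sigma>"
begin

definition hproj :: "'a \<Rightarrow> ('a, 'm) tvec \<Rightarrow> ('a, 'm) tvec" where
  "hproj p v = (THE w. w \<in> \<Sigma> p \<and> (\<forall>u\<in>\<Sigma> p. g p (v - w) u = 0))"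

definition hnabla :: "'a \<Rightarrow> ('a, 'm) tvec \<Rightarrow> ('a, 'm) vfield \<Rightarrow> ('a, 'm) tvec" where
  "hnabla p v Y = hproj p (nabla p v Y)"

definition hnabla_along :: "(real \<Rightarrow> 'a) \<Rightarrow> (real \<Rightarrow> ('a, 'm) tvec) \<Rightarrow> real \<Rightarrow> ('a, 'm) tvec" where
  "hnabla_along \<gamma> Z t = hproj (\<gamma> t) (nabla_along \<gamma> Z t)"

definition horizontal_curve :: "real set \<Rightarrow> (real \<Rightarrow> 'a) \<Rightarrow> bool" where
  "horizontal_curve I \<gamma> \<longleftrightarrow> smooth_curve I \<gamma> \<and> (\<forall>t\<in>I. velocity \<gamma> t \<in> \<Sigma> (\<gamma> t))"

definition nonholonomic_geodesic :: "real set \<Rightarrow> (real \<Rightarrow> 'a) \<Rightarrow> bool" where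
  "nonholonomic_geodesic I \<gamma> \<longleftrightarrow>
     horizontal_curve I \<gamma> \<and> (\<forall>t\<in>I. hnabla_along \<gamma> (velocity \<gamma>) t = 0)"

definition hgrad :: "('a \<Rightarrow> real) \<Rightarrow> ('a, 'm) vfield" where
  "hgrad f p = (THE w. w \<in> \<Sigma> p \<and> (\<forall>v\<in>\<Sigma> p. g p v w = differential f p v))"

definition hHess :: "('a \<Rightarrow> real) \<Rightarrow> 'a \<Rightarrow> ('a, 'm) tvec \<Rightarrow> ('a, 'm) tvec \<Rightarrow> real" where
  "hHess f p v w =
     (g p (hnabla p v (hgrad f)) w + g p (hnabla p w (hgrad f)) v) / 2"

definition n_convex :: "('a \<Rightarrow> real) \<Rightarrow> bool" where
  "n_convex f \<longleftrightarrow> (\<forall>I \<gamma>. nonholonomic_geodesic I \<gamma> \<longrightarrow> convex_on I (f \<circ> \<gamma>))"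

end

end

theory Submission
  imports Defs
begin

text \<open>
  Along a nonholonomic geodesic \<open>\<gamma>\<close> the first derivative of \<open>f \<circ> \<gamma>\<close> is \<open>g(\<gamma>', \<nabla>\<^sup>H f)\<close>, because \<open>\<gamma>'\<close> is
  horizontal.  Metric compatibility of the Levi-Civita connection gives
  \<open>(f \<circ> \<gamma>)'' = g(\<nabla>\<^bsub>\<gamma>'\<^esub> \<gamma>', \<nabla>\<^sup>H f) + g(\<gamma>', \<nabla>\<^bsub>\<gamma>'\<^esub> \<nabla>\<^sup>H f)\<close>.  The first term is zero, since the geodesic
  equation says that \<open>\<nabla>\<^bsub>\<gamma>'\<^esub> \<gamma>'\<close> is orthogonal to \<open>\<Sigma>\<close>, and the second one is the horizontal Hessian on
  \<open>(\<gamma>', \<gamma>')\<close>: this is \<open>second_derivative_along_geodesic\<close>.  If the Hessian is positive semidefinite,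
  \<open>f \<circ> \<gamma>\<close> therefore has nonnegative second derivative and is convex.  Conversely, every
  \<open>v \<in> \<Sigma>\<^sub>p\<close> is the initial velocity of some geodesic (\<open>geodesic_exists\<close>), and the second derivative of
  the convex function \<open>f \<circ> \<gamma>\<close> at the initial time is the Hessian on \<open>(v, v)\<close>.

  Geodesics come from a first-order system of ordinary differential equations with smooth right-hand
  side; the solution is found by Picard iteration and is smooth by bootstrapping, for which
  \<open>C\<^sup>n\<close> maps are shown to be closed under composition.

  The rank of \<open>\<Sigma>\<close> is a number and not a type, whereas the phase space of the system has to be a
  Euclidean space.  The coefficients with respect to \<open>\<Sigma>\<close> are therefore indexed by the coordinate
  indices of the manifold, and orthonormal frames are replaced by families \<open>E\<^sub>j\<close>, some of whose
  members may vanish, with \<open>u = \<Sum>\<^sub>j g(u, E\<^sub>j) E\<^sub>j\<close> for all \<open>u \<in> \<Sigma>\<close>.  This Parseval identity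
  yields the projection \<open>\<P> v = \<Sum>\<^sub>j g(v, E\<^sub>j) E\<^sub>j\<close>, the smoothness of \<open>\<nabla>\<^sup>H f = \<Sum>\<^sub>j (E\<^sub>j f) E\<^sub>j\<close> and
  the coefficients \<open>g(\<gamma>', E\<^sub>j)\<close> of a velocity.
\<close>

section \<open>Calculus of smooth maps between Euclidean spaces\<close>

lemma Ck_on_subset: "Ck_on n S f \<Longrightarrow> T \<subseteq> S \<Longrightarrow> Ck_on n T f"
  by (induction n arbitrary: f) (auto intro: continuous_on_subset)

lemma Ck_on_cong:
  assumes "open S" "\<And>x. x \<in> S \<Longrightarrow> f x = h x" "Ck_on n S f"
  shows "Ck_on n S h"
  using assms(2,3)
proof (induction n arbitrary: f h)
  case 0
  then show ?case by (simp cong: continuous_on_cong)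
next
  case (Suc n)
  have d: "(h has_derivative frechet_derivative f (at x)) (at x)" if "x \<in> S" for x
    using that Suc.prems \<open>open S\<close>
    by (auto intro!: has_derivative_transform_within_open[of f _ x UNIV S h]
        simp: frechet_derivative_works[symmetric])
  then have eq: "frechet_derivative f (at x) = frechet_derivative h (at x)" if "x \<in> S" for x
    using that frechet_derivative_at by blast
  have "Ck_on n S (\<lambda>x. frechet_derivative h (at x) v)" for v
    by (rule Suc.IH[of "\<lambda>x. frechet_derivative f (at x) v"]) (use Suc.prems eq in auto)
  with d show ?case by (auto simp: differentiable_def)
qed

lemma Ck_on_continuous: "Ck_on n S f \<Longrightarrow> continuous_on S f"
  by (cases n) (auto intro!: differentiable_imp_continuous_on
      simp: differentiable_on_def differentiable_at_withinI)

lemma Ck_on_SucD: "Ck_on (Suc n) S f \<Longrightarrow> Ck_on n S f"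
proof (induction n arbitrary: f)
  case 0
  then show ?case using Ck_on_continuous[of "Suc 0" S f] by simp
next
  case (Suc n)
  show ?case unfolding Ck_on.simps(2)[of n]
  proof (intro conjI allI)
    show "\<forall>x\<in>S. f differentiable at x" using Suc.prems by simp
    fix v
    show "Ck_on n S (\<lambda>x. frechet_derivative f (at x) v)"
      using Suc.prems by (intro Suc.IH) (subst (asm) Ck_on.simps(2), blast)
  qed
qed

text \<open>Any explicit formula for the derivative may be used to establish the next order of
  differentiability, which keeps the choice hidden in \<open>frechet_derivative\<close> out of later proofs.\<close>

lemma Ck_on_SucI:
  assumes "open S" "\<And>x. x \<in> S \<Longrightarrow> (f has_derivative f' x) (at x)"
    and "\<And>v. Ck_on n S (\<lambda>x. f' x v)"
  shows "Ck_on (Suc n) S f"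
proof -
  have "f' x = frechet_derivative f (at x)" if "x \<in> S" for x
    using assms(2)[OF that] frechet_derivative_at by blast
  then have "Ck_on n S (\<lambda>x. frechet_derivative f (at x) v)" for v
    using assms by (intro Ck_on_cong[OF assms(1) _ assms(3)[of v]]) auto
  then show ?thesis using assms(2) by (auto simp: differentiable_def)
qed

lemma Ck_on_Suc_derivative:
  "Ck_on (Suc n) S f \<Longrightarrow> x \<in> S \<Longrightarrow> (f has_derivative frechet_derivative f (at x)) (at x)"
  by (simp add: frechet_derivative_works[symmetric])

lemma Ck_on_const: "Ck_on n S (\<lambda>x. a)"
proof (induction n arbitrary: a)
  case (Suc n)
  then show ?case by (simp add: frechet_derivative_const)
qed simp

lemma Ck_on_linear:
  assumes "bounded_linear L" "open S" "Ck_on n S f"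
  shows "Ck_on n S (\<lambda>x. L (f x))"
  using assms(3)
proof (induction n arbitrary: f)
  case 0
  then show ?case using assms(1) by (simp add: bounded_linear.continuous_on)
next
  case (Suc n)
  show ?case
  proof (rule Ck_on_SucI[OF \<open>open S\<close>])
    show "((\<lambda>x. L (f x)) has_derivative (\<lambda>v. L (frechet_derivative f (at x) v))) (at x)"
      if "x \<in> S" for x
      by (rule bounded_linear.has_derivative[OF assms(1) Ck_on_Suc_derivative[OF Suc.prems that]])
    show "Ck_on n S (\<lambda>x. L (frechet_derivative f (at x) v))" for v
      using Suc by simp
  qed
qed

lemma Ck_on_id: "Ck_on n S (\<lambda>x. x)"
proof (cases n)
  case (Suc n)
  then show ?thesis by (simp add: Ck_on_const)
qed simp

lemma Ck_on_add:
  assumes "open S" "Ck_on n S f" "Ck_on n S h"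
  shows "Ck_on n S (\<lambda>x. f x + h x)"
  using assms(2,3)
proof (induction n arbitrary: f h)
  case 0
  then show ?case by (simp add: continuous_on_add)
next
  case (Suc n)
  show ?case
  proof (rule Ck_on_SucI[OF \<open>open S\<close>])
    show "((\<lambda>x. f x + h x) has_derivative
        (\<lambda>v. frechet_derivative f (at x) v + frechet_derivative h (at x) v)) (at x)"
      if "x \<in> S" for x
      using Suc.prems that by (intro has_derivative_add Ck_on_Suc_derivative)
    show "Ck_on n S (\<lambda>x. frechet_derivative f (at x) v + frechet_derivative h (at x) v)" for v
      using Suc by simp
  qed
qed

lemma Ck_on_sum:
  assumes "open S" "\<And>i. i \<in> J \<Longrightarrow> Ck_on n S (f i)"
  shows "Ck_on n S (\<lambda>x. \<Sum>i\<in>J. f i x)"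
  using assms(2)
  by (induction J rule: infinite_finite_induct) (auto intro!: Ck_on_const Ck_on_add \<open>open S\<close>)

lemma Ck_on_bilinear:
  assumes "bounded_bilinear B" "open S" "Ck_on n S f" "Ck_on n S h"
  shows "Ck_on n S (\<lambda>x. B (f x) (h x))"
  using assms(3,4)
proof (induction n arbitrary: f h)
  case 0
  then show ?case using assms(1) by (simp add: bounded_bilinear.continuous_on)
next
  case (Suc n)
  show ?case
  proof (rule Ck_on_SucI[OF \<open>open S\<close>])
    show "((\<lambda>x. B (f x) (h x)) has_derivative
        (\<lambda>v. B (f x) (frechet_derivative h (at x) v) + B (frechet_derivative f (at x) v) (h x))) (at x)"
      if "x \<in> S" for x
      using Suc.prems that
      by (intro bounded_bilinear.FDERIV[OF assms(1)] Ck_on_Suc_derivative)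
    show "Ck_on n S (\<lambda>x. B (f x) (frechet_derivative h (at x) v) + B (frechet_derivative f (at x) v) (h x))"
      for v
      using Suc Suc.prems[THEN Ck_on_SucD] by (intro Ck_on_add[OF \<open>open S\<close>] Suc.IH) auto
  qed
qed

lemma linear_expand_Basis:
  fixes L :: "'b::euclidean_space \<Rightarrow> 'c::real_vector"
  assumes "linear L"
  shows "L w = (\<Sum>b\<in>Basis. (w \<bullet> b) *\<^sub>R L b)"
  by (metis (no_types, lifting) assms euclidean_representation linear_cmul linear_sum sum.cong)

text \<open>The chain rule expresses the derivatives of a composite through products of derivatives of one
  order less.  Expanding the inner derivative in a basis turns the operator-valued outer derivative
  into finitely many directional derivatives, which is where the middle space has to be
  finite-dimensional.\<close>

lemma Ck_on_compose:
  fixes f :: "'a::real_normed_vector \<Rightarrow> 'b::euclidean_space"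
    and h :: "'b \<Rightarrow> 'c::real_normed_vector"
  assumes "open S" "open T" "f ` S \<subseteq> T" "Ck_on n S f" "Ck_on n T h"
  shows "Ck_on n S (\<lambda>x. h (f x))"
  using assms(4,5)
proof (induction n arbitrary: h)
  case 0
  then show ?case using assms(3) by (auto intro: continuous_on_compose2)
next
  case (Suc n)
  let ?f' = "\<lambda>x. frechet_derivative f (at x)" and ?h' = "\<lambda>y. frechet_derivative h (at y)"
  show ?case
  proof (rule Ck_on_SucI[OF \<open>open S\<close>])
    fix x assume x: "x \<in> S"
    have f: "(f has_derivative ?f' x) (at x)"
      by (rule Ck_on_Suc_derivative[OF Suc.prems(1) x])
    have h: "(h has_derivative ?h' (f x)) (at (f x))"
      using x assms(3) by (intro Ck_on_Suc_derivative[OF Suc.prems(2)]) auto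
    have "((\<lambda>x. h (f x)) has_derivative (\<lambda>v. ?h' (f x) (?f' x v))) (at x)"
      using has_derivative_compose[OF f h] .
    moreover have "?h' (f x) (?f' x v) = (\<Sum>b\<in>Basis. (?f' x v \<bullet> b) *\<^sub>R ?h' (f x) b)" for v
      by (rule linear_expand_Basis[OF has_derivative_linear[OF h]])
    ultimately show "((\<lambda>x. h (f x)) has_derivative
        (\<lambda>v. \<Sum>b\<in>Basis. (?f' x v \<bullet> b) *\<^sub>R ?h' (f x) b)) (at x)"
      by simp
  next
    fix v
    have "Ck_on n S (\<lambda>x. ?h' (f x) b)" for b
      using Suc.prems Ck_on_SucD[OF Suc.prems(1)] by (intro Suc.IH) auto
    moreover have "Ck_on n S (\<lambda>x. ?f' x v \<bullet> b)" for b
      using Suc.prems(1)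
      by (intro Ck_on_linear[OF bounded_linear_inner_left \<open>open S\<close>]) auto
    ultimately show "Ck_on n S (\<lambda>x. \<Sum>b\<in>Basis. (?f' x v \<bullet> b) *\<^sub>R ?h' (f x) b)"
      by (intro Ck_on_sum Ck_on_bilinear[OF bounded_bilinear_scaleR] \<open>open S\<close>)
  qed
qed

lemma smooth_on_subset: "smooth_on S f \<Longrightarrow> T \<subseteq> S \<Longrightarrow> smooth_on T f"
  by (auto simp: smooth_on_def intro: Ck_on_subset)

lemma smooth_on_cong:
  "open S \<Longrightarrow> smooth_on S f \<Longrightarrow> (\<And>x. x \<in> S \<Longrightarrow> f x = h x) \<Longrightarrow> smooth_on S h"
  by (auto simp: smooth_on_def intro: Ck_on_cong)

lemma smooth_on_continuous: "smooth_on S f \<Longrightarrow> continuous_on S f"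
  unfolding smooth_on_def using Ck_on_continuous by blast

lemma smooth_on_has_derivative:
  "smooth_on S f \<Longrightarrow> x \<in> S \<Longrightarrow> (f has_derivative frechet_derivative f (at x)) (at x)"
  unfolding smooth_on_def using Ck_on_Suc_derivative by blast

lemma smooth_on_const: "smooth_on S (\<lambda>x. a)"
  by (simp add: smooth_on_def Ck_on_const)

lemma smooth_on_id: "smooth_on S (\<lambda>x. x)"
  by (simp add: smooth_on_def Ck_on_id)

lemma smooth_on_linear:
  "bounded_linear L \<Longrightarrow> open S \<Longrightarrow> smooth_on S f \<Longrightarrow> smooth_on S (\<lambda>x. L (f x))"
  by (simp add: smooth_on_def Ck_on_linear)

lemma smooth_on_add:
  "open S \<Longrightarrow> smooth_on S f \<Longrightarrow> smooth_on S h \<Longrightarrow> smooth_on S (\<lambda>x. f x + h x)"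
  by (simp add: smooth_on_def Ck_on_add)

lemma smooth_on_sum:
  "open S \<Longrightarrow> (\<And>i. i \<in> J \<Longrightarrow> smooth_on S (f i)) \<Longrightarrow> smooth_on S (\<lambda>x. \<Sum>i\<in>J. f i x)"
  by (simp add: smooth_on_def Ck_on_sum)

lemma smooth_on_scaleR:
  "open S \<Longrightarrow> smooth_on S f \<Longrightarrow> smooth_on S h \<Longrightarrow> smooth_on S (\<lambda>x. f x *\<^sub>R h x)"
  by (simp add: smooth_on_def Ck_on_bilinear[OF bounded_bilinear_scaleR])

lemma smooth_on_mult:
  fixes f h :: "'a::real_normed_vector \<Rightarrow> real"
  shows "open S \<Longrightarrow> smooth_on S f \<Longrightarrow> smooth_on S h \<Longrightarrow> smooth_on S (\<lambda>x. f x * h x)"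
  using smooth_on_scaleR[of S f h] by simp

lemma smooth_on_compose:
  fixes f :: "'a::real_normed_vector \<Rightarrow> 'b::euclidean_space"
  assumes "open S" "open T" "smooth_on S f" "smooth_on T h" "\<And>x. x \<in> S \<Longrightarrow> f x \<in> T"
  shows "smooth_on S (\<lambda>x. h (f x))"
  using assms by (auto simp: smooth_on_def intro: Ck_on_compose)

lemma smooth_on_Pair:
  assumes "open S" "smooth_on S f" "smooth_on S h"
  shows "smooth_on S (\<lambda>x. (f x, h x))"
proof -
  have "smooth_on S (\<lambda>x. (f x, 0) + (0, h x))"
    using assms
    by (intro smooth_on_add smooth_on_linear[of "\<lambda>y. (y, 0)"] smooth_on_linear[of "\<lambda>y. (0, y)"]
        bounded_linear_Pair bounded_linear_ident bounded_linear_zero)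
  then show ?thesis by simp
qed

lemma smooth_on_vec_lambda:
  fixes f :: "'i::finite \<Rightarrow> 'a::real_normed_vector \<Rightarrow> real"
  assumes "open S" "\<And>i. smooth_on S (f i)"
  shows "smooth_on S (\<lambda>x. \<chi> i. f i x)"
proof -
  have "(\<chi> i. f i x) = (\<Sum>i\<in>UNIV. f i x *\<^sub>R axis i 1)" for x
    by (simp add: vec_eq_iff axis_def if_distrib cong: if_cong)
  then show ?thesis
    using assms by (auto intro!: smooth_on_sum smooth_on_scaleR smooth_on_const)
qed

lemma smooth_on_directional_derivative:
  "smooth_on S f \<Longrightarrow> smooth_on S (\<lambda>x. frechet_derivative f (at x) v)"
  unfolding smooth_on_def by (metis Ck_on.simps(2))

lemma smooth_on_frechet_derivative_apply:
  fixes f :: "'a::euclidean_space \<Rightarrow> 'b::real_normed_vector"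
  assumes "open S" "smooth_on S f" "smooth_on S w"
  shows "smooth_on S (\<lambda>x. frechet_derivative f (at x) (w x))"
proof -
  have "smooth_on S (\<lambda>x. \<Sum>b\<in>Basis. (w x \<bullet> b) *\<^sub>R frechet_derivative f (at x) b)"
    using assms
    by (intro smooth_on_sum smooth_on_scaleR smooth_on_directional_derivative
        smooth_on_linear[OF bounded_linear_inner_left])
  then show ?thesis
    by (rule smooth_on_cong[OF assms(1)])
      (metis smooth_on_has_derivative[OF assms(2)] has_derivative_linear linear_expand_Basis)
qed

text \<open>All exponents are treated at once because differentiation lowers the exponent by one.\<close>

lemma smooth_on_powr: "smooth_on {0<..} (\<lambda>x::real. x powr a)"
proof -
  have "Ck_on n {0<..} (\<lambda>x::real. x powr a)" for n
  proof (induction n arbitrary: a)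
    case 0
    then show ?case by (auto intro!: continuous_intros)
  next
    case (Suc n)
    show ?case
    proof (rule Ck_on_SucI)
      show "((\<lambda>x. x powr a) has_derivative (\<lambda>v. (v * a) * x powr (a - 1))) (at x)"
        if "x \<in> {0<..}" for x :: real
        using has_real_derivative_powr[of x a] that
        by (auto simp: has_field_derivative_def fun_eq_iff mult_ac intro: has_derivative_eq_rhs)
      show "Ck_on n {0<..} (\<lambda>x. (v * a) * x powr (a - 1))" for v
        by (intro Ck_on_linear[OF bounded_linear_mult_right] Suc.IH) simp
    qed simp
  qed
  then show ?thesis by (simp add: smooth_on_def)
qed

section \<open>Local solutions of smooth ordinary differential equations\<close>

text \<open>The Picard iteration contracts on a short interval.  The integral curve is sought among the bounded
  continuous functions on the whole line, a complete space; the clamped upper limit of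
  integration makes every iterate bounded.\<close>

lemma lipschitz_ode_solution:
  fixes G :: "'a::euclidean_space \<Rightarrow> 'a"
  assumes lip: "\<And>x y. norm (G x - G y) \<le> L * norm (x - y)"
  obtains z e where "0 < e" "z 0 = z0"
    "\<And>t. t \<in> {-e<..<e} \<Longrightarrow> (z has_vector_derivative G (z t)) (at t)"
proof -
  define B where "B = \<bar>L\<bar> + 1"
  have B: "0 < B" by (simp add: B_def)
  have lipB: "norm (G x - G y) \<le> B * norm (x - y)" for x y
    by (rule order_trans[OF lip]) (auto simp: B_def intro: mult_right_mono)
  \<comment> \<open>Both integrals in \<open>T\<close> run over intervals of length at most \<open>2 e\<close>, so \<open>T\<close> has Lipschitz
    constant \<open>4 e B = 1/2\<close>.\<close>
  define e where "e = 1 / (8 * B)"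
  have e: "0 < e" "4 * e * B = 1/2" using B by (auto simp: e_def)
  define cl where "cl t = max (-e) (min e t)" for t
  have cl: "cl t \<in> {-e..e}" for t using e by (auto simp: cl_def)
  define H where "H z t = integral {-e..t} (\<lambda>s. G (z s))" for z :: "real \<Rightarrow> 'a" and t
  define T where "T z t = z0 + H z (cl t) - H z 0" for z t
  have "continuous_on UNIV G"
    unfolding continuous_on_iff
  proof (intro ballI allI impI)
    fix x :: 'a and r :: real assume "0 < r"
    then have "dist (G y) (G x) < r" if "dist y x < r / B" for y
      using lipB[of y x] that B by (simp add: dist_norm pos_less_divide_eq mult.commute)
    then show "\<exists>d>0. \<forall>y\<in>UNIV. dist y x < d \<longrightarrow> dist (G y) (G x) < r"
      using \<open>0 < r\<close> B by (intro exI[of _ "r / B"]) auto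
  qed
  then have contG: "continuous_on S (\<lambda>s. G (z s))" if "continuous_on UNIV z" for z :: "real \<Rightarrow> 'a" and S
    using that by (metis continuous_on_compose2 continuous_on_subset subset_UNIV)
  have contH: "continuous_on {-e..e} (H z)" if "continuous_on UNIV z" for z
    unfolding H_def
    by (intro indefinite_integral_continuous_1 integrable_continuous_real contG that)
  have T_bcont: "T z \<in> bcontfun" if z: "continuous_on UNIV z" for z
  proof -
    have "continuous_on UNIV (\<lambda>t. H z (cl t))"
      using cl by (intro continuous_on_compose2[OF contH[OF z]]) (auto simp: cl_def intro!: continuous_intros)
    then have "continuous_on UNIV (T z)"
      unfolding T_def by (intro continuous_intros)
    moreover have "bounded ((\<lambda>u. z0 + u - H z 0) ` H z ` {-e..e})"
      by (intro compact_imp_bounded compact_continuous_image contH z continuous_intros) auto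
    then have "bounded (range (T z))"
      by (rule bounded_subset) (use cl in \<open>auto simp: T_def\<close>)
    ultimately show ?thesis by (simp add: bcontfun_def)
  qed
  define P where "P z = Bcontfun (T (apply_bcontfun z))" for z
  have P: "apply_bcontfun (P z) = T (apply_bcontfun z)" for z
    unfolding P_def by (intro Bcontfun_inverse T_bcont continuous_on_apply_bcontfun continuous_on_id)
  have diffH: "norm (H z t - H w t) \<le> 2 * e * B * dist z w" if "t \<in> {-e..e}"
    for z w :: "real \<Rightarrow>\<^sub>C 'a" and t
  proof -
    have c: "continuous_on {-e..t} (\<lambda>s. G (apply_bcontfun z s))" for z :: "real \<Rightarrow>\<^sub>C 'a"
      by (intro contG continuous_on_apply_bcontfun continuous_on_id)
    have "H z t - H w t = integral {-e..t} (\<lambda>s. G (z s) - G (w s))"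
      unfolding H_def by (subst integral_diff) (auto intro: integrable_continuous_real c)
    also have "norm \<dots> \<le> (B * dist z w) * (t - (-e))"
    proof (rule integral_bound)
      fix s
      have "norm (G (z s) - G (w s)) \<le> B * dist (z s) (w s)"
        using lipB by (simp add: dist_norm)
      also have "\<dots> \<le> B * dist z w"
        using B by (intro mult_left_mono dist_bounded) auto
      finally show "norm (G (z s) - G (w s)) \<le> B * dist z w" .
    qed (use that in \<open>auto intro!: continuous_intros c\<close>)
    also have "\<dots> \<le> (B * dist z w) * (2 * e)"
      using that B by (intro mult_left_mono) auto
    finally show ?thesis by (simp add: mult_ac)
  qed
  have "dist (P z) (P w) \<le> 1/2 * dist z w" for z w
  proof (rule dist_bound)
    fix t
    have "dist (P z t) (P w t) = norm ((H z (cl t) - H w (cl t)) - (H z 0 - H w 0))"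
      by (simp add: P T_def dist_norm algebra_simps)
    also have "\<dots> \<le> 2 * e * B * dist z w + 2 * e * B * dist z w"
      using e cl by (intro order_trans[OF norm_triangle_ineq4] add_mono diffH) auto
    also have "\<dots> = (4 * e * B) * dist z w" by simp
    finally show "dist (P z t) (P w t) \<le> 1/2 * dist z w" unfolding e(2) .
  qed
  then have "\<exists>!z. P z = z"
    by (intro banach_fix_type[where c="1/2"]) auto
  then obtain z where "P z = z" by blast
  then have z: "apply_bcontfun z = T (apply_bcontfun z)" using P by metis
  show thesis
  proof (rule that[OF e(1)])
    show "z 0 = z0"
      by (subst z) (use e in \<open>simp add: T_def cl_def\<close>)
    fix t assume t: "t \<in> {-e<..<e}"
    have "((\<lambda>t. H z t) has_vector_derivative G (z t)) (at t within {-e..e})"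
      unfolding H_def using t
      by (intro integral_has_vector_derivative contG continuous_on_apply_bcontfun continuous_on_id) auto
    then have "((\<lambda>t. H z t) has_vector_derivative G (z t)) (at t)"
      using t at_within_interior[of t "{-e..e}"] by simp
    then have "((\<lambda>t. z0 + H z t - H z 0) has_vector_derivative G (z t)) (at t)"
      by (auto intro!: derivative_eq_intros)
    then show "(z has_vector_derivative G (z t)) (at t)"
    proof (rule has_vector_derivative_transform_within_open)
      show "z0 + H z s - H z 0 = z s" if "s \<in> {-e<..<e}" for s
        by (subst (3) z) (use that in \<open>simp add: T_def cl_def\<close>)
    qed (use t in auto)
  qed
qed

text \<open>The directional derivatives along a basis are bounded on the compact ball, hence so is the operator norm
  of the derivative, and the mean value inequality applies on the convex ball.\<close>

lemma smooth_on_lipschitz_cball: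
  fixes F :: "'a::euclidean_space \<Rightarrow> 'b::real_normed_vector"
  assumes "smooth_on S F" "cball x0 r \<subseteq> S"
  obtains L where "\<And>x y. x \<in> cball x0 r \<Longrightarrow> y \<in> cball x0 r \<Longrightarrow> norm (F x - F y) \<le> L * norm (x - y)"
proof -
  let ?F' = "\<lambda>x. frechet_derivative F (at x)"
  have "\<exists>C. \<forall>x\<in>cball x0 r. norm (?F' x b) \<le> C" for b
  proof -
    have "continuous_on (cball x0 r) (\<lambda>x. ?F' x b)"
      using assms smooth_on_continuous[OF smooth_on_directional_derivative] continuous_on_subset by blast
    then have "bounded ((\<lambda>x. ?F' x b) ` cball x0 r)"
      by (intro compact_imp_bounded compact_continuous_image) auto
    then show ?thesis by (auto simp: bounded_iff)
  qed
  then obtain C where C: "norm (?F' x b) \<le> C b" if "x \<in> cball x0 r" for x b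
    by metis
  have der: "(F has_derivative ?F' x) (at x)" if "x \<in> cball x0 r" for x
    using assms that by (intro smooth_on_has_derivative) auto
  have "onorm (?F' x) \<le> (\<Sum>b\<in>Basis. C b)" if x: "x \<in> cball x0 r" for x
  proof (rule onorm_le)
    fix v
    have "norm (?F' x v) = norm (\<Sum>b\<in>Basis. (v \<bullet> b) *\<^sub>R ?F' x b)"
      using linear_expand_Basis[OF has_derivative_linear[OF der[OF x]]] by metis
    also have "\<dots> \<le> (\<Sum>b\<in>Basis. norm v * C b)"
    proof (rule sum_norm_le)
      fix b :: 'a assume "b \<in> Basis"
      then show "norm ((v \<bullet> b) *\<^sub>R ?F' x b) \<le> norm v * C b"
        using C[OF x, of b] by (auto intro!: mult_mono Basis_le_norm)
    qed
    finally show "norm (?F' x v) \<le> (\<Sum>b\<in>Basis. C b) * norm v"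
      by (simp add: sum_distrib_left mult.commute)
  qed
  then show thesis
    using that differentiable_bound[of "cball x0 r" F ?F' "\<Sum>b\<in>Basis. C b"] der
    by (meson convex_cball has_derivative_at_withinI)
qed

text \<open>Bootstrapping: if \<open>z\<close> is \<open>C\<^sup>n\<close> then so is \<open>z' = F \<circ> z\<close>, so \<open>z\<close> is \<open>C\<^sup>n\<^sup>+\<^sup>1\<close>.\<close>

lemma smooth_on_ode_solution:
  fixes F :: "'a::euclidean_space \<Rightarrow> 'a"
  assumes "open I" "open S" "smooth_on S F" "\<And>t. t \<in> I \<Longrightarrow> z t \<in> S"
    and ode: "\<And>t. t \<in> I \<Longrightarrow> (z has_vector_derivative F (z t)) (at t)"
  shows "smooth_on I z"
proof -
  have "Ck_on n I z" for n
  proof (induction n)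
    case 0
    then show ?case
      using ode has_vector_derivative_continuous continuous_at_imp_continuous_on by (metis Ck_on.simps(1))
  next
    case (Suc n)
    show ?case
    proof (rule Ck_on_SucI[OF \<open>open I\<close>])
      show "(z has_derivative (\<lambda>v. v *\<^sub>R F (z t))) (at t)" if "t \<in> I" for t
        using ode[OF that] by (simp add: has_vector_derivative_def)
      have "Ck_on n I (\<lambda>t. F (z t))"
        using assms Suc by (intro Ck_on_compose[of I S z n F]) (auto simp: smooth_on_def)
      then show "Ck_on n I (\<lambda>t. v *\<^sub>R F (z t))" for v
        by (intro Ck_on_linear[OF bounded_linear_scaleR_right \<open>open I\<close>])
    qed
  qed
  then show ?thesis by (simp add: smooth_on_def)
qed

text \<open>Precomposing the vector field with the nearest-point projection onto a closed ball extends it from the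
  ball to a globally Lipschitz one; for a short time the solution does not leave the ball.\<close>

lemma smooth_ode_local_solution:
  fixes F :: "'a::euclidean_space \<Rightarrow> 'a"
  assumes "open S" "smooth_on S F" "z0 \<in> S"
  obtains z e where "0 < e" "z 0 = z0" "\<And>t. t \<in> {-e<..<e} \<Longrightarrow> z t \<in> S" "smooth_on {-e<..<e} z"
    "\<And>t. t \<in> {-e<..<e} \<Longrightarrow> (z has_vector_derivative F (z t)) (at t)"
proof -
  obtain r where r: "0 < r" "cball z0 r \<subseteq> S"
    using assms open_contains_cball by blast
  obtain L where L: "norm (F x - F y) \<le> L * norm (x - y)"
    if "x \<in> cball z0 r" "y \<in> cball z0 r" for x y
    using smooth_on_lipschitz_cball[OF assms(2) r(2)] by blast
  let ?\<pi> = "closest_point (cball z0 r)"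
  have \<pi>: "?\<pi> x \<in> cball z0 r" for x
    using r by (intro closest_point_in_set) auto
  have "norm (F (?\<pi> x) - F (?\<pi> y)) \<le> \<bar>L\<bar> * norm (x - y)" for x y
  proof -
    have "norm (F (?\<pi> x) - F (?\<pi> y)) \<le> \<bar>L\<bar> * norm (?\<pi> x - ?\<pi> y)"
      using \<pi> by (intro order_trans[OF L] mult_right_mono) auto
    also have "\<dots> \<le> \<bar>L\<bar> * norm (x - y)"
      using closest_point_lipschitz[of "cball z0 r" x y] r
      by (intro mult_left_mono) (auto simp: dist_norm)
    finally show ?thesis .
  qed
  then obtain z d where z: "0 < d" "z 0 = z0"
    "\<And>t. t \<in> {-d<..<d} \<Longrightarrow> (z has_vector_derivative F (?\<pi> (z t))) (at t)"
    using lipschitz_ode_solution[of "\<lambda>x. F (?\<pi> x)" "\<bar>L\<bar>" z0] by metis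
  then have "isCont z 0"
    by (intro has_vector_derivative_continuous[OF z(3)]) auto
  then obtain e' where e': "0 < e'" "\<And>t. dist t 0 < e' \<Longrightarrow> dist (z t) z0 < r"
    using r(1) z(2) unfolding continuous_at_eps_delta by (metis dist_norm)
  define e where "e = min d e'"
  have ball: "z t \<in> cball z0 r" if "t \<in> {-e<..<e}" for t
  proof -
    have "dist t 0 < e'" using that by (auto simp: e_def dist_norm)
    from e'(2)[OF this] show ?thesis by (simp add: dist_commute)
  qed
  have ode: "(z has_vector_derivative F (z t)) (at t)" if "t \<in> {-e<..<e}" for t
  proof -
    have "t \<in> {-d<..<d}" using that by (auto simp: e_def)
    from z(3)[OF this] show ?thesis using closest_point_self[OF ball[OF that]] by simp
  qed
  show thesis
  proof (rule that[OF _ z(2) _ _ ode])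
    show "0 < e" using z(1) e' by (simp add: e_def)
    show S: "z t \<in> S" if "t \<in> {-e<..<e}" for t using ball[OF that] r by blast
    show "smooth_on {-e<..<e} z"
      by (rule smooth_on_ode_solution[OF _ assms(1,2) S ode]) auto
  qed
qed

section \<open>Functions, vector fields and curves in charts\<close>

lemma sum_fun_apply: "(\<Sum>i\<in>J. F i) x = (\<Sum>i\<in>J. F i x)"
  by (induction J rule: infinite_finite_induct) auto

lemma scaleR_fun_apply: "(r *\<^sub>R f) x = r *\<^sub>R f x"
  by (simp add: scaleR_fun_def)

context smooth_manifold
begin

lemma openin_chart: "c \<in> A \<Longrightarrow> openin M (fst c)"
  using charts by (auto simp: is_chart_def)

lemma chart_inv_left: "c \<in> A \<Longrightarrow> p \<in> fst c \<Longrightarrow> chart_inv c (snd c p) = p"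
proof -
  assume c: "c \<in> A" and p: "p \<in> fst c"
  have "inj_on (snd c) (topspace (subtopology M (fst c)))"
    using charts[OF c] homeomorphic_imp_injective_map unfolding is_chart_def by blast
  moreover have "topspace (subtopology M (fst c)) = fst c"
    using openin_subset[OF openin_chart[OF c]] by auto
  ultimately show ?thesis using p by (simp add: chart_inv_def)
qed

lemma chart_inv_image:
  assumes "c \<in> A" "x \<in> snd c ` (fst c \<inter> V)"
  shows "chart_inv c x \<in> fst c" "chart_inv c x \<in> V" "snd c (chart_inv c x) = x"
  using assms(2) by (auto simp: chart_inv_left[OF assms(1)])

lemma open_chart_image:
  assumes "c \<in> A" "openin M V"
  shows "open (snd c ` (fst c \<inter> V))"
proof -
  have "open_map (subtopology M (fst c)) (top_of_set (snd c ` fst c)) (snd c)"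
    using charts[OF assms(1)] homeomorphic_imp_open_map unfolding is_chart_def by blast
  moreover have "openin (subtopology M (fst c)) (fst c \<inter> V)"
    using assms(2) by (simp add: openin_subtopology_Int2)
  ultimately have "openin (top_of_set (snd c ` fst c)) (snd c ` (fst c \<inter> V))"
    unfolding open_map_def by blast
  then show ?thesis
    using charts[OF assms(1)] openin_open_trans unfolding is_chart_def by blast
qed

lemma open_chart_image_subset:
  "c \<in> A \<Longrightarrow> openin M V \<Longrightarrow> V \<subseteq> fst c \<Longrightarrow> open (snd c ` V)"
  using open_chart_image[of c V] by (simp add: Int_absorb1)

lemma chart_of_in:
  assumes "p \<in> topspace M"
  shows "chart_of p \<in> charts_at p"
proof -
  obtain c where "c \<in> charts_at p" using assms unfolding cover[symmetric] charts_at_def by blast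
  then show ?thesis unfolding chart_of_def by (rule someI)
qed

lemma smooth_transition_map:
  "c \<in> A \<Longrightarrow> d \<in> A \<Longrightarrow> smooth_on (snd c ` (fst c \<inter> fst d)) (snd d \<circ> chart_inv c)"
  using transition by (simp add: smooth_transition_def)

lemma smooth_fun_chart_map: "d \<in> A \<Longrightarrow> smooth_fun (fst d) (snd d)"
  by (simp add: smooth_fun_def smooth_transition_map)

lemma smooth_fun_subset: "smooth_fun V h \<Longrightarrow> W \<subseteq> V \<Longrightarrow> smooth_fun W h"
  unfolding smooth_fun_def by (meson Int_mono image_mono order_refl smooth_on_subset)

lemma smooth_vfield_subset: "smooth_vfield V Y \<Longrightarrow> W \<subseteq> V \<Longrightarrow> smooth_vfield W Y"
  unfolding smooth_vfield_def by (meson Int_mono image_mono order_refl smooth_on_subset subsetD)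

lemma smooth_fun_has_derivative:
  assumes "smooth_fun V h" "p \<in> V" "c \<in> charts_at p"
  shows "(h \<circ> chart_inv c has_derivative frechet_derivative (h \<circ> chart_inv c) (at (snd c p)))
    (at (snd c p))"
  using assms by (intro smooth_on_has_derivative[of "snd c ` (fst c \<inter> V)"])
    (auto simp: smooth_fun_def charts_at_def)

text \<open>The chain rule behind every independence of charts below.  Taking \<open>h\<close> to be a chart map gives the cocycle
  identity of the transition maps.\<close>

lemma frechet_derivative_change_chart:
  assumes "openin M V" "smooth_fun V h" "p \<in> V" "c \<in> charts_at p" "d \<in> charts_at p"
  shows "frechet_derivative (h \<circ> chart_inv c) (at (snd c p)) w =
    frechet_derivative (h \<circ> chart_inv d) (at (snd d p))
      (frechet_derivative (snd d \<circ> chart_inv c) (at (snd c p)) w)"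
proof -
  have A: "c \<in> A" "d \<in> A" "p \<in> fst c" "p \<in> fst d" using assms by (auto simp: charts_at_def)
  let ?\<phi> = "snd d \<circ> chart_inv c"
  have \<phi>: "?\<phi> (snd c p) = snd d p" using A by (simp add: chart_inv_left)
  have "((h \<circ> chart_inv d) \<circ> ?\<phi> has_derivative
      frechet_derivative (h \<circ> chart_inv d) (at (snd d p)) \<circ> frechet_derivative ?\<phi> (at (snd c p)))
      (at (snd c p))"
    using smooth_fun_has_derivative[OF smooth_fun_chart_map, of d p c]
      smooth_fun_has_derivative[OF assms(2,3,5)] A assms(4) \<phi>
    by (intro diff_chain_at) auto
  then have "(h \<circ> chart_inv c has_derivative
      frechet_derivative (h \<circ> chart_inv d) (at (snd d p)) \<circ> frechet_derivative ?\<phi> (at (snd c p)))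
      (at (snd c p))"
  proof (rule has_derivative_transform_within_open)
    show "open (snd c ` (fst c \<inter> fst d))" by (intro open_chart_image openin_chart A)
    show "snd c p \<in> snd c ` (fst c \<inter> fst d)" using A by auto
    show "((h \<circ> chart_inv d) \<circ> ?\<phi>) x = (h \<circ> chart_inv c) x" if "x \<in> snd c ` (fst c \<inter> fst d)" for x
      using that A by (auto simp: chart_inv_left)
  qed
  from frechet_derivative_at[OF this] show ?thesis by (metis comp_apply)
qed

lemma tangent_change_chart:
  "v \<in> tangent p \<Longrightarrow> c \<in> charts_at p \<Longrightarrow> d \<in> charts_at p \<Longrightarrow>
    v d = frechet_derivative (snd d \<circ> chart_inv c) (at (snd c p)) (v c)"
  unfolding tangent_def by blast

lemma tangent_outside: "v \<in> tangent p \<Longrightarrow> c \<notin> charts_at p \<Longrightarrow> v c = 0"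
  unfolding tangent_def by blast

text \<open>By the chain rule for transition maps, the transformation law need only be checked out of one fixed
  chart.\<close>

lemma tangentI_chart:
  assumes c: "c \<in> charts_at p"
    and "\<And>d. d \<in> charts_at p \<Longrightarrow> v d = frechet_derivative (snd d \<circ> chart_inv c) (at (snd c p)) w"
    and "\<And>d. d \<notin> charts_at p \<Longrightarrow> v d = 0"
  shows "v \<in> tangent p"
  unfolding tangent_def mem_Collect_eq
proof (intro conjI ballI allI impI)
  fix d e assume d: "d \<in> charts_at p" and e: "e \<in> charts_at p"
  then show "v e = frechet_derivative (snd e \<circ> chart_inv d) (at (snd d p)) (v d)"
    using assms frechet_derivative_change_chart[OF openin_chart smooth_fun_chart_map _ c d, of e w]
    by (auto simp: charts_at_def)
qed (use assms in auto)

lemma linear_transition: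
  assumes "c \<in> charts_at p" "d \<in> charts_at p"
  shows "linear (frechet_derivative (snd d \<circ> chart_inv c) (at (snd c p)))"
  using assms
  by (intro has_derivative_linear[OF smooth_fun_has_derivative[OF smooth_fun_chart_map]])
    (auto simp: charts_at_def)

lemma subspace_tangent: "subspace (tangent p)"
proof (rule subspaceI)
  show "0 \<in> tangent p"
    using linear_0[OF linear_transition] by (simp add: tangent_def)
  show "u + v \<in> tangent p" if uv: "u \<in> tangent p" "v \<in> tangent p" for u v
    unfolding tangent_def mem_Collect_eq
  proof (intro conjI ballI allI impI)
    fix c d assume cd: "c \<in> charts_at p" "d \<in> charts_at p"
    show "(u + v) d = frechet_derivative (snd d \<circ> chart_inv c) (at (snd c p)) ((u + v) c)"
      using uv[THEN tangent_change_chart[OF _ cd]] linear_add[OF linear_transition[OF cd]]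
      by simp
  qed (use uv[THEN tangent_outside] in simp)
  show "r *\<^sub>R u \<in> tangent p" if u: "u \<in> tangent p" for r u
    unfolding tangent_def mem_Collect_eq
  proof (intro conjI ballI allI impI)
    fix c d assume cd: "c \<in> charts_at p" "d \<in> charts_at p"
    show "(r *\<^sub>R u) d = frechet_derivative (snd d \<circ> chart_inv c) (at (snd c p)) ((r *\<^sub>R u) c)"
      using tangent_change_chart[OF u cd] linear_cmul[OF linear_transition[OF cd]]
      by (simp add: scaleR_fun_apply)
  qed (use tangent_outside[OF u] in \<open>simp add: scaleR_fun_apply\<close>)
qed

lemma differential_chart:
  assumes "openin M V" "smooth_fun V h" "p \<in> V" "v \<in> tangent p" "c \<in> charts_at p"
  shows "differential h p v = frechet_derivative (h \<circ> chart_inv c) (at (snd c p)) (v c)"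
proof -
  have "chart_of p \<in> charts_at p"
    using assms openin_subset by (intro chart_of_in) blast
  then show ?thesis
    unfolding differential_def
    using assms frechet_derivative_change_chart[of V h p "chart_of p" c] tangent_change_chart by metis
qed

lemma linear_differential:
  assumes "openin M V" "smooth_fun V h" "p \<in> V"
  shows "linear (differential h p)"
proof -
  have "chart_of p \<in> charts_at p"
    using assms openin_subset by (intro chart_of_in) blast
  then have "linear (frechet_derivative (h \<circ> chart_inv (chart_of p)) (at (snd (chart_of p) p)))"
    using smooth_fun_has_derivative assms has_derivative_linear by blast
  then show ?thesis
    unfolding differential_def
    by (intro linearI) (simp_all add: scaleR_fun_apply linear_add linear_cmul)
qed

text \<open>Transition maps are smooth, so on a subset of one chart domain no other chart has to be examined.\<close>

lemma smooth_funI_chart: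
  assumes "d \<in> A" "openin M V" "V \<subseteq> fst d" "smooth_on (snd d ` V) (\<lambda>x. h (chart_inv d x))"
  shows "smooth_fun V h"
  unfolding smooth_fun_def
proof
  fix c assume c: "c \<in> A"
  have "smooth_on (snd c ` (fst c \<inter> V)) (\<lambda>x. h (chart_inv d ((snd d \<circ> chart_inv c) x)))"
  proof (rule smooth_on_compose[OF _ _ _ assms(4)])
    show "smooth_on (snd c ` (fst c \<inter> V)) (snd d \<circ> chart_inv c)"
      by (rule smooth_on_subset[OF smooth_transition_map]) (use assms c in auto)
  qed (use assms c chart_inv_image[OF c] in \<open>auto intro: open_chart_image open_chart_image_subset\<close>)
  then show "smooth_on (snd c ` (fst c \<inter> V)) (h \<circ> chart_inv c)"
    by (rule smooth_on_cong[OF open_chart_image[OF c assms(2)]])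
      (use assms c in \<open>auto simp: chart_inv_left\<close>)
qed

text \<open>The components in another chart arise from those in the given one by applying the derivative of the
  transition map, which is again smooth.\<close>

lemma smooth_vfieldI_chart:
  assumes "d \<in> A" "openin M V" "V \<subseteq> fst d" "\<And>p. p \<in> V \<Longrightarrow> Y p \<in> tangent p"
    and "smooth_on (snd d ` V) (\<lambda>x. Y (chart_inv d x) d)"
  shows "smooth_vfield V Y"
  unfolding smooth_vfield_def
proof (intro conjI ballI assms(4))
  fix c assume c: "c \<in> A"
  let ?S = "snd c ` (fst c \<inter> V)" and ?T = "snd d ` (fst d \<inter> (fst c \<inter> V))"
  have cV: "openin M (fst c \<inter> V)" using openin_chart[OF c] assms(2) by auto
  have S: "open ?S" and T: "open ?T"
    by (intro open_chart_image assms c cV)+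
  have \<psi>: "smooth_on ?T (\<lambda>x. frechet_derivative (snd c \<circ> chart_inv d) (at x) (Y (chart_inv d x) d))"
    by (intro smooth_on_frechet_derivative_apply smooth_on_subset[OF smooth_transition_map[OF assms(1) c]]
        smooth_on_subset[OF assms(5)] T) auto
  have "smooth_on ?S (\<lambda>x. frechet_derivative (snd c \<circ> chart_inv d) (at ((snd d \<circ> chart_inv c) x))
      (Y (chart_inv d ((snd d \<circ> chart_inv c) x)) d))"
  proof (rule smooth_on_compose[OF S T _ \<psi>])
    show "smooth_on ?S (snd d \<circ> chart_inv c)"
      by (rule smooth_on_subset[OF smooth_transition_map]) (use assms c in auto)
  qed (use assms c in \<open>auto simp: chart_inv_left\<close>)
  then show "smooth_on ?S (\<lambda>x. Y (chart_inv c x) c)"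
  proof (rule smooth_on_cong[OF S])
    fix x assume "x \<in> ?S"
    then obtain q where q: "x = snd c q" "q \<in> fst c" "q \<in> V" by auto
    have "c \<in> charts_at q" "d \<in> charts_at q" using q c assms by (auto simp: charts_at_def)
    then show "frechet_derivative (snd c \<circ> chart_inv d) (at ((snd d \<circ> chart_inv c) x))
        (Y (chart_inv d ((snd d \<circ> chart_inv c) x)) d) = Y (chart_inv c x) c"
      using q c assms(1,3,4) tangent_change_chart[of "Y q" q d c]
      by (auto simp: chart_inv_left)
  qed
qed

lemma smooth_vfield_cong:
  assumes "openin M V" "smooth_vfield V Y" "\<And>q. q \<in> V \<Longrightarrow> Y q = Z q"
  shows "smooth_vfield V Z"
  unfolding smooth_vfield_def
proof (intro conjI ballI)
  show "Z q \<in> tangent q" if "q \<in> V" for q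
    using assms that unfolding smooth_vfield_def by metis
  fix c assume c: "c \<in> A"
  then have "smooth_on (snd c ` (fst c \<inter> V)) (\<lambda>x. Y (chart_inv c x) c)"
    using assms(2) unfolding smooth_vfield_def by blast
  then show "smooth_on (snd c ` (fst c \<inter> V)) (\<lambda>x. Z (chart_inv c x) c)"
    by (rule smooth_on_cong[OF open_chart_image[OF c assms(1)]])
      (use assms(3) chart_inv_image(2)[OF c] in simp)
qed

lemma smooth_vfield_zero: "smooth_vfield V (\<lambda>q. 0)"
  by (simp add: smooth_vfield_def smooth_on_const subspace_0[OF subspace_tangent])

lemma smooth_vfield_add:
  assumes "openin M V" "smooth_vfield V Y" "smooth_vfield V Z"
  shows "smooth_vfield V (\<lambda>q. Y q + Z q)"
  using assms unfolding smooth_vfield_def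
  by (auto intro: subspace_add[OF subspace_tangent] smooth_on_add open_chart_image)

lemma smooth_vfield_scale:
  assumes "openin M V" "smooth_fun V h" "smooth_vfield V Y"
  shows "smooth_vfield V (\<lambda>q. h q *\<^sub>R Y q)"
  using assms unfolding smooth_vfield_def smooth_fun_def
  by (auto simp: scaleR_fun_apply comp_def
      intro: subspace_scale[OF subspace_tangent] smooth_on_scaleR open_chart_image)

lemma smooth_vfield_sum:
  assumes "openin M V" "\<And>i. i \<in> J \<Longrightarrow> smooth_vfield V (Y i)"
  shows "smooth_vfield V (\<lambda>q. \<Sum>i\<in>J. Y i q)"
  using assms(2)
  by (induction J rule: infinite_finite_induct)
    (auto intro: smooth_vfield_zero smooth_vfield_add assms(1))

lemma smooth_fun_const: "smooth_fun V (\<lambda>q. a)"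
  by (simp add: smooth_fun_def comp_def smooth_on_const)

lemma smooth_fun_powr:
  fixes h :: "'a \<Rightarrow> real"
  assumes "openin M V" "smooth_fun V h" "\<And>q. q \<in> V \<Longrightarrow> 0 < h q"
  shows "smooth_fun V (\<lambda>q. h q powr a)"
  unfolding smooth_fun_def
proof
  fix c assume c: "c \<in> A"
  have "smooth_on (snd c ` (fst c \<inter> V)) (\<lambda>x. (h \<circ> chart_inv c) x powr a)"
  proof (rule smooth_on_compose[OF open_chart_image[OF c assms(1)] _ _ smooth_on_powr])
    show "smooth_on (snd c ` (fst c \<inter> V)) (h \<circ> chart_inv c)"
      using assms(2) c unfolding smooth_fun_def by blast
  qed (use assms(3) chart_inv_image(2)[OF c] in simp_all)
  then show "smooth_on (snd c ` (fst c \<inter> V)) ((\<lambda>q. h q powr a) \<circ> chart_inv c)"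
    by (simp add: comp_def)
qed

lemma smooth_fun_component:
  assumes "openin M V" "smooth_vfield V Y" "d \<in> A"
  shows "smooth_fun (V \<inter> fst d) (\<lambda>q. Y q d $ i)"
proof (rule smooth_funI_chart[OF assms(3)])
  show o: "openin M (V \<inter> fst d)" using assms(1) openin_chart[OF assms(3)] by (rule openin_Int)
  show "smooth_on (snd d ` (V \<inter> fst d)) (\<lambda>x. Y (chart_inv d x) d $ i)"
    using assms(2,3) unfolding smooth_vfield_def
    by (intro smooth_on_linear[OF bounded_linear_vec_nth open_chart_image_subset[OF assms(3) o]])
      (auto simp: Int_commute)
qed auto

lemma smooth_fun_differential:
  assumes "openin M V" "smooth_fun V h" "smooth_vfield V Y"
  shows "smooth_fun V (\<lambda>q. differential h q (Y q))"
  unfolding smooth_fun_def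
proof
  fix c assume c: "c \<in> A"
  let ?S = "snd c ` (fst c \<inter> V)"
  have S: "open ?S" using c assms(1) by (rule open_chart_image)
  have "smooth_on ?S (\<lambda>x. frechet_derivative (h \<circ> chart_inv c) (at x) (Y (chart_inv c x) c))"
    using assms c unfolding smooth_fun_def smooth_vfield_def
    by (intro smooth_on_frechet_derivative_apply S) auto
  then show "smooth_on ?S ((\<lambda>q. differential h q (Y q)) \<circ> chart_inv c)"
  proof (rule smooth_on_cong[OF S])
    fix x assume "x \<in> ?S"
    then have "chart_inv c x \<in> V" "c \<in> charts_at (chart_inv c x)" "snd c (chart_inv c x) = x"
      using chart_inv_image[OF c] c by (auto simp: charts_at_def)
    then show "frechet_derivative (h \<circ> chart_inv c) (at x) (Y (chart_inv c x) c) =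
        ((\<lambda>q. differential h q (Y q)) \<circ> chart_inv c) x"
      using assms(3) differential_chart[OF assms(1,2), of "chart_inv c x" "Y (chart_inv c x)" c]
      by (simp add: smooth_vfield_def)
  qed
qed

lemma coord_field_self:
  assumes "d \<in> charts_at q"
  shows "coord_field d i q d = axis i 1"
proof -
  have d: "d \<in> A" "q \<in> fst d" using assms by (auto simp: charts_at_def)
  have "((\<lambda>x. x) has_derivative (\<lambda>x. x)) (at (snd d q))" by (rule has_derivative_ident)
  then have "(snd d \<circ> chart_inv d has_derivative (\<lambda>x. x)) (at (snd d q))"
    by (rule has_derivative_transform_within_open[OF _ open_chart_image_subset[OF d(1) openin_chart]])
      (use d in \<open>auto simp: chart_inv_left\<close>)
  from frechet_derivative_at[OF this] show ?thesis
    using assms by (simp add: coord_field_def fun_eq_iff)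
qed

lemma smooth_vfield_coord_field:
  assumes d: "d \<in> A"
  shows "smooth_vfield (fst d) (coord_field d i)"
proof (rule smooth_vfieldI_chart[OF d openin_chart[OF d]])
  fix p assume "p \<in> fst d"
  then show "coord_field d i p \<in> tangent p"
    using d by (intro tangentI_chart[of d p _ "axis i 1"]) (auto simp: coord_field_def charts_at_def)
next
  show "smooth_on (snd d ` fst d) (\<lambda>x. coord_field d i (chart_inv d x) d)"
  proof (rule smooth_on_cong[OF open_chart_image_subset[OF d openin_chart[OF d]] smooth_on_const])
    show "axis i 1 = coord_field d i (chart_inv d x) d" if "x \<in> snd d ` fst d" for x
      using that d coord_field_self[of d] by (auto simp: charts_at_def chart_inv_left)
  qed auto
qed auto

lemma coord_field_expansion:
  assumes "d \<in> charts_at q" "v \<in> tangent q"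
  shows "(\<Sum>i\<in>UNIV. (v d $ i) *\<^sub>R coord_field d i q) = v"
proof
  fix e
  show "(\<Sum>i\<in>UNIV. (v d $ i) *\<^sub>R coord_field d i q) e = v e"
  proof (cases "e \<in> charts_at q")
    case True
    let ?D = "frechet_derivative (snd e \<circ> chart_inv d) (at (snd d q))"
    have "?D (v d) = ?D (\<Sum>i\<in>UNIV. (v d $ i) *\<^sub>R axis i 1)"
      using basis_expansion[of "v d"] by (simp add: scalar_mult_eq_scaleR)
    also have "\<dots> = (\<Sum>i\<in>UNIV. (v d $ i) *\<^sub>R ?D (axis i 1))"
      using linear_transition[OF assms(1) True] by (simp add: linear_sum linear_cmul)
    finally show ?thesis
      using True tangent_change_chart[OF assms(2,1) True]
      by (simp add: sum_fun_apply scaleR_fun_apply coord_field_def)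
  next
    case False
    then show ?thesis
      using tangent_outside[OF assms(2)]
      by (simp add: sum_fun_apply scaleR_fun_apply coord_field_def)
  qed
qed

lemma open_curve_preimage:
  assumes "smooth_curve I \<gamma>" "openin M V"
  shows "open {t \<in> I. \<gamma> t \<in> V}"
proof -
  have "openin (top_of_set I) {t \<in> topspace (top_of_set I). \<gamma> t \<in> V}"
    using assms by (intro openin_continuous_map_preimage) (auto simp: smooth_curve_def)
  then show ?thesis
    using assms openin_open_trans by (auto simp: smooth_curve_def)
qed

lemma curve_in_topspace: "smooth_curve I \<gamma> \<Longrightarrow> t \<in> I \<Longrightarrow> \<gamma> t \<in> topspace M"
  by (auto simp: smooth_curve_def continuous_map_def)

lemma smooth_on_chart_curve:
  "smooth_curve I \<gamma> \<Longrightarrow> d \<in> A \<Longrightarrow> smooth_on {t \<in> I. \<gamma> t \<in> fst d} (snd d \<circ> \<gamma>)"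
  by (simp add: smooth_curve_def)

lemma velocity_has_vector_derivative:
  assumes "smooth_curve I \<gamma>" "t \<in> I" "d \<in> charts_at (\<gamma> t)"
  shows "(snd d \<circ> \<gamma> has_vector_derivative velocity \<gamma> t d) (at t)"
proof -
  have "snd d \<circ> \<gamma> differentiable at t"
    using assms smooth_on_has_derivative[OF smooth_on_chart_curve[OF assms(1)], of d t]
    by (auto simp: differentiable_def charts_at_def)
  then show ?thesis
    using assms(3) by (simp add: velocity_def vector_derivative_works)
qed

lemma has_vector_derivative_along_curve:
  assumes \<gamma>: "smooth_curve I \<gamma>" "t \<in> I" and V: "openin M V" "\<gamma> t \<in> V" "smooth_fun V h"
  shows "(h \<circ> \<gamma> has_vector_derivative differential h (\<gamma> t) (velocity \<gamma> t)) (at t)"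
proof -
  define c where "c = chart_of (\<gamma> t)"
  have c: "c \<in> charts_at (\<gamma> t)"
    unfolding c_def using curve_in_topspace[OF \<gamma>] by (rule chart_of_in)
  then have cA: "c \<in> A" "\<gamma> t \<in> fst c" by (auto simp: charts_at_def)
  let ?D = "frechet_derivative (h \<circ> chart_inv c) (at (snd c (\<gamma> t)))"
  have D: "(h \<circ> chart_inv c has_derivative ?D) (at (snd c (\<gamma> t)))"
    by (rule smooth_fun_has_derivative[OF V(3,2) c])
  have "((h \<circ> chart_inv c) \<circ> (snd c \<circ> \<gamma>) has_derivative ?D \<circ> (\<lambda>s. s *\<^sub>R velocity \<gamma> t c)) (at t)"
    using velocity_has_vector_derivative[OF \<gamma> c] D
    by (intro diff_chain_at) (auto simp: has_vector_derivative_def)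
  then have "((h \<circ> chart_inv c) \<circ> (snd c \<circ> \<gamma>) has_vector_derivative ?D (velocity \<gamma> t c)) (at t)"
    using has_derivative_linear[OF D] by (simp add: has_vector_derivative_def comp_def linear_cmul)
  then have "(h \<circ> \<gamma> has_vector_derivative ?D (velocity \<gamma> t c)) (at t)"
    by (rule has_vector_derivative_transform_within_open[OF _ open_curve_preimage[OF \<gamma>(1) openin_chart]])
      (use cA \<gamma> in \<open>auto simp: chart_inv_left\<close>)
  then show ?thesis by (simp add: differential_def c_def)
qed

lemma velocity_in_tangent:
  assumes "smooth_curve I \<gamma>" "t \<in> I"
  shows "velocity \<gamma> t \<in> tangent (\<gamma> t)"
proof -
  have c: "chart_of (\<gamma> t) \<in> charts_at (\<gamma> t)"
    using curve_in_topspace[OF assms] by (rule chart_of_in)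
  have "velocity \<gamma> t d = differential (snd d) (\<gamma> t) (velocity \<gamma> t)" if d: "d \<in> charts_at (\<gamma> t)" for d
  proof (rule vector_derivative_unique_at[OF velocity_has_vector_derivative[OF assms d]])
    show "(snd d \<circ> \<gamma> has_vector_derivative differential (snd d) (\<gamma> t) (velocity \<gamma> t)) (at t)"
      using d by (intro has_vector_derivative_along_curve[OF assms openin_chart _ smooth_fun_chart_map])
        (auto simp: charts_at_def)
  qed
  then show ?thesis
    by (intro tangentI_chart[OF c, of _ "velocity \<gamma> t (chart_of (\<gamma> t))"])
      (auto simp: differential_def velocity_def)
qed

text \<open>Transports the solution of a differential equation in one chart to the manifold.\<close>

lemma smooth_curve_of_chart:
  assumes c: "c \<in> A" and J: "open J" "is_interval J" and x: "smooth_on J x"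
    and im: "\<And>t. t \<in> J \<Longrightarrow> x t \<in> snd c ` fst c"
  shows "smooth_curve J (chart_inv c \<circ> x)"
proof -
  have pre: "{t \<in> J. chart_inv c (x t) \<in> V} = {t \<in> J. x t \<in> snd c ` (fst c \<inter> V)}" for V
  proof (intro Collect_cong conj_cong refl iffI)
    fix t assume t: "t \<in> J"
    then obtain q where q: "q \<in> fst c" "x t = snd c q" using im by blast
    then have "chart_inv c (x t) = q" by (simp add: chart_inv_left[OF c])
    then show "x t \<in> snd c ` (fst c \<inter> V)" if "chart_inv c (x t) \<in> V" using that q by blast
    show "chart_inv c (x t) \<in> V" if "x t \<in> snd c ` (fst c \<inter> V)"
      using that by (rule chart_inv_image(2)[OF c])
  qed
  have open_pre: "open {t \<in> J. chart_inv c (x t) \<in> V}" if "openin M V" for V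
  proof -
    have "open (J \<inter> x -` (snd c ` (fst c \<inter> V)))"
      using smooth_on_continuous[OF x] open_chart_image[OF c that] J(1)
      by (simp add: continuous_on_open_vimage Int_commute)
    then show ?thesis unfolding pre by (simp add: Collect_conj_eq vimage_def)
  qed
  have "continuous_map (top_of_set J) M (chart_inv c \<circ> x)"
    unfolding continuous_map_def
  proof (intro conjI allI impI)
    show "chart_inv c \<circ> x \<in> topspace (top_of_set J) \<rightarrow> topspace M"
      using im chart_inv_left[OF c] openin_subset[OF openin_chart[OF c]] by fastforce
    show "openin (top_of_set J) {t \<in> topspace (top_of_set J). (chart_inv c \<circ> x) t \<in> V}"
      if "openin M V" for V
      using open_subset[OF _ open_pre[OF that]] by auto
  qed
  moreover have "smooth_on {t \<in> J. (chart_inv c \<circ> x) t \<in> fst d} (snd d \<circ> (chart_inv c \<circ> x))"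
    if d: "d \<in> A" for d
  proof -
    have "smooth_on {t \<in> J. chart_inv c (x t) \<in> fst d} (\<lambda>t. (snd d \<circ> chart_inv c) (x t))"
      by (intro smooth_on_compose[OF _ _ _ smooth_transition_map[OF c d]] open_pre open_chart_image
          openin_chart c d smooth_on_subset[OF x]) (auto simp: pre)
    then show ?thesis by (simp add: comp_def)
  qed
  ultimately show ?thesis using J by (simp add: smooth_curve_def)
qed

end

section \<open>The covariant derivative in frames\<close>

context smooth_manifold
begin

lemma tangent_eqI:
  assumes "u \<in> tangent p" "v \<in> tangent p" "c \<in> charts_at p" "u c = v c"
  shows "u = v"
proof
  fix d
  show "u d = v d"
    using assms tangent_change_chart[OF assms(1,3), of d] tangent_change_chart[OF assms(2,3), of d]
      tangent_outside[OF assms(1), of d] tangent_outside[OF assms(2), of d]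
    by metis
qed

lemma smooth_vfield_tangent: "smooth_vfield V Y \<Longrightarrow> p \<in> V \<Longrightarrow> Y p \<in> tangent p"
  by (simp add: smooth_vfield_def)

lemma tangent_sum: "(\<And>j. j \<in> J \<Longrightarrow> v j \<in> tangent p) \<Longrightarrow> (\<Sum>j\<in>J. a j *\<^sub>R v j) \<in> tangent p"
  by (intro subspace_sum subspace_scale subspace_tangent)

end

context riemannian_manifold
begin

lemma metric_zero_left: "p \<in> topspace M \<Longrightarrow> v \<in> tangent p \<Longrightarrow> g p 0 v = 0"
  using metric_scale[of p v v 0] by simp

lemma metric_diff:
  assumes "p \<in> topspace M" "u \<in> tangent p" "v \<in> tangent p" "w \<in> tangent p"
  shows "g p (u - v) w = g p u w - g p v w"
  using assms metric_add[of p u "(-1) *\<^sub>R v" w] metric_scale[of p v w "-1"]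
    subspace_scale[OF subspace_tangent, of v p "-1"]
  by simp

lemma metric_sum_left:
  assumes "p \<in> topspace M" "w \<in> tangent p" "\<And>j. j \<in> J \<Longrightarrow> v j \<in> tangent p"
  shows "g p (\<Sum>j\<in>J. a j *\<^sub>R v j) w = (\<Sum>j\<in>J. a j * g p (v j) w)"
  using assms(3)
proof (induction J rule: infinite_finite_induct)
  case (insert x J)
  have "g p (\<Sum>j\<in>insert x J. a j *\<^sub>R v j) w = g p (a x *\<^sub>R v x + (\<Sum>j\<in>J. a j *\<^sub>R v j)) w"
    by (rule arg_cong[OF sum.insert[OF insert.hyps], where f = "\<lambda>u. g p u w"])
  also have "\<dots> = g p (a x *\<^sub>R v x) w + g p (\<Sum>j\<in>J. a j *\<^sub>R v j) w"
    using insert.prems by (intro metric_add assms(1,2) tangent_sum subspace_scale[OF subspace_tangent]) auto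
  also have "\<dots> = a x * g p (v x) w + (\<Sum>j\<in>J. a j * g p (v j) w)"
    using insert assms(1,2) by (simp add: metric_scale)
  also have "\<dots> = (\<Sum>j\<in>insert x J. a j * g p (v j) w)"
    using insert.hyps by simp
  finally show ?case .
qed (use assms in \<open>auto simp: metric_zero_left\<close>)

lemma metric_sum_right:
  assumes "p \<in> topspace M" "w \<in> tangent p" "\<And>j. j \<in> J \<Longrightarrow> v j \<in> tangent p"
  shows "g p w (\<Sum>j\<in>J. a j *\<^sub>R v j) = (\<Sum>j\<in>J. a j * g p w (v j))"
proof -
  have "g p w (\<Sum>j\<in>J. a j *\<^sub>R v j) = g p (\<Sum>j\<in>J. a j *\<^sub>R v j) w"
    by (intro metric_sym assms(1,2) tangent_sum assms(3))
  also have "\<dots> = (\<Sum>j\<in>J. a j * g p (v j) w)"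
    by (intro metric_sum_left assms)
  finally show ?thesis
    using assms metric_sym[OF assms(1,2)] by simp
qed

lemma metric_eq_0D: "p \<in> topspace M \<Longrightarrow> v \<in> tangent p \<Longrightarrow> g p v v = 0 \<Longrightarrow> v = 0"
  using metric_pos[of p v] by fastforce

end

context levi_civita_connection
begin

lemma nabla_zero_right:
  assumes "openin M V" "p \<in> V" "v \<in> tangent p"
  shows "nabla p v (\<lambda>q. 0) = 0"
proof -
  have "nabla p v (\<lambda>q. 0 + 0) = nabla p v (\<lambda>q. 0) + nabla p v (\<lambda>q. 0)"
    by (rule nabla_add_right[OF assms smooth_vfield_zero smooth_vfield_zero])
  then show ?thesis by simp
qed

lemma nabla_sum_right:
  assumes "openin M V" "p \<in> V" "v \<in> tangent p" "\<And>j. j \<in> J \<Longrightarrow> smooth_vfield V (Y j)"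
  shows "nabla p v (\<lambda>q. \<Sum>j\<in>J. Y j q) = (\<Sum>j\<in>J. nabla p v (Y j))"
  using assms(4)
proof (induction J rule: infinite_finite_induct)
  case (insert x J)
  have "nabla p v (\<lambda>q. \<Sum>j\<in>insert x J. Y j q) = nabla p v (\<lambda>q. Y x q + (\<Sum>j\<in>J. Y j q))"
    by (rule arg_cong[OF ext[OF sum.insert[OF insert.hyps]], where f = "nabla p v"])
  also have "\<dots> = nabla p v (Y x) + nabla p v (\<lambda>q. \<Sum>j\<in>J. Y j q)"
    using insert.prems by (intro nabla_add_right[OF assms(1-3)] smooth_vfield_sum assms(1)) auto
  also have "\<dots> = nabla p v (Y x) + (\<Sum>j\<in>J. nabla p v (Y j))"
    using insert by simp
  also have "\<dots> = (\<Sum>j\<in>insert x J. nabla p v (Y j))"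
    by (rule sum.insert[OF insert.hyps, symmetric])
  finally show ?case .
qed (use assms in \<open>auto simp: nabla_zero_right\<close>)

lemma nabla_sum_left:
  assumes "openin M V" "p \<in> V" "\<And>j. j \<in> J \<Longrightarrow> v j \<in> tangent p" "smooth_vfield V Y"
  shows "nabla p (\<Sum>j\<in>J. a j *\<^sub>R v j) Y = (\<Sum>j\<in>J. a j *\<^sub>R nabla p (v j) Y)"
proof -
  have z: "nabla p 0 Y = 0"
    using nabla_scale_left[OF assms(1,2) subspace_0[OF subspace_tangent] assms(4), of 0] by simp
  show ?thesis
    using assms(3)
  proof (induction J rule: infinite_finite_induct)
    case (insert x J)
    have "nabla p (\<Sum>j\<in>insert x J. a j *\<^sub>R v j) Y = nabla p (a x *\<^sub>R v x + (\<Sum>j\<in>J. a j *\<^sub>R v j)) Y"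
      by (rule arg_cong[OF sum.insert[OF insert.hyps], where f = "\<lambda>u. nabla p u Y"])
    also have "\<dots> = nabla p (a x *\<^sub>R v x) Y + nabla p (\<Sum>j\<in>J. a j *\<^sub>R v j) Y"
      using insert.prems
      by (intro nabla_add_left[OF assms(1,2) _ _ assms(4)] tangent_sum
          subspace_scale[OF subspace_tangent]) auto
    also have "\<dots> = a x *\<^sub>R nabla p (v x) Y + (\<Sum>j\<in>J. a j *\<^sub>R nabla p (v j) Y)"
      using insert nabla_scale_left[OF assms(1,2) _ assms(4)] by simp
    also have "\<dots> = (\<Sum>j\<in>insert x J. a j *\<^sub>R nabla p (v j) Y)"
      by (rule sum.insert[OF insert.hyps, symmetric])
    finally show ?case .
  qed (simp_all add: z)
qed

text \<open>The Leibniz rule for the expansion of the field in the coordinate fields of the chart.\<close>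

lemma nabla_chart:
  assumes "openin M V" "p \<in> V" "v \<in> tangent p" "smooth_vfield V Y" "d \<in> charts_at p"
  shows "nabla p v Y = (\<Sum>i\<in>UNIV. differential (\<lambda>q. Y q d $ i) p v *\<^sub>R coord_field d i p +
    (Y p d $ i) *\<^sub>R nabla p v (coord_field d i))"
proof -
  have d: "d \<in> A" "p \<in> fst d" using assms by (auto simp: charts_at_def)
  define W where "W = V \<inter> fst d"
  have W: "openin M W" "p \<in> W"
    using assms(1,2) d openin_chart[OF d(1)] by (auto simp: W_def)
  have Yi: "smooth_fun W (\<lambda>q. Y q d $ i)" for i
    unfolding W_def by (rule smooth_fun_component[OF assms(1,4) d(1)])
  have D: "smooth_vfield W (coord_field d i)" for i
    by (rule smooth_vfield_subset[OF smooth_vfield_coord_field[OF d(1)]]) (simp add: W_def)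
  have YD: "smooth_vfield W (\<lambda>q. (Y q d $ i) *\<^sub>R coord_field d i q)" for i
    by (rule smooth_vfield_scale[OF W(1) Yi D])
  have "nabla p v Y = nabla p v (\<lambda>q. \<Sum>i\<in>UNIV. (Y q d $ i) *\<^sub>R coord_field d i q)"
  proof (rule nabla_local[OF W assms(3)])
    show "smooth_vfield W Y" by (rule smooth_vfield_subset[OF assms(4)]) (simp add: W_def)
    show "smooth_vfield W (\<lambda>q. \<Sum>i\<in>UNIV. (Y q d $ i) *\<^sub>R coord_field d i q)"
      by (rule smooth_vfield_sum[OF W(1) YD])
    show "Y q = (\<Sum>i\<in>UNIV. (Y q d $ i) *\<^sub>R coord_field d i q)" if "q \<in> W" for q
      using that d(1) smooth_vfield_tangent[OF assms(4), of q]
      by (intro coord_field_expansion[symmetric]) (auto simp: W_def charts_at_def)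
  qed
  then show ?thesis
    by (simp add: nabla_sum_right[OF W assms(3) YD] nabla_Leibniz[OF W assms(3) Yi D])
qed

text \<open>The covariant derivative along a curve is defined through the coordinate fields of a chart that may
  change from one parameter value to the next.  The following product rule replaces the
  coordinate fields by any smooth fields in terms of which the field along the curve has
  differentiable coefficients.\<close>

lemma nabla_along_frame:
  fixes E :: "'j::finite \<Rightarrow> ('a, 'm) vfield" and a :: "'j \<Rightarrow> real \<Rightarrow> real"
  assumes \<gamma>: "smooth_curve I \<gamma>" "t \<in> I" and V: "openin M V" "\<gamma> t \<in> V"
    and E: "\<And>j. smooth_vfield V (E j)"
    and a: "\<And>j. (a j has_real_derivative a' j) (at t)"
    and Z: "\<And>s. s \<in> I \<Longrightarrow> \<gamma> s \<in> V \<Longrightarrow> Z s = (\<Sum>j\<in>UNIV. a j s *\<^sub>R E j (\<gamma> s))"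
  shows "nabla_along \<gamma> Z t = (\<Sum>j\<in>UNIV. a' j *\<^sub>R E j (\<gamma> t) +
    a j t *\<^sub>R nabla (\<gamma> t) (velocity \<gamma> t) (E j))"
proof -
  define d where "d = chart_of (\<gamma> t)"
  let ?p = "\<gamma> t" and ?v = "velocity \<gamma> t"
  have d: "d \<in> charts_at ?p"
    unfolding d_def using curve_in_topspace[OF \<gamma>] by (rule chart_of_in)
  then have dA: "d \<in> A" "?p \<in> fst d" by (auto simp: charts_at_def)
  define D where "D j i = differential (\<lambda>q. E j q d $ i) ?p ?v" for j i
  have Ej: "((\<lambda>s. E j (\<gamma> s) d $ i) has_real_derivative D j i) (at t)" for j i
    using has_vector_derivative_along_curve[OF \<gamma> openin_Int[OF V(1) openin_chart[OF dA(1)]] _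
        smooth_fun_component[OF V(1) E dA(1)], of j i] V(2) dA(2)
    by (simp add: comp_def D_def has_real_derivative_iff_has_vector_derivative)
  have "deriv (\<lambda>s. Z s d $ i) t = (\<Sum>j\<in>UNIV. a' j * (E j ?p d $ i) + a j t * D j i)" for i
  proof (rule DERIV_imp_deriv)
    have "((\<lambda>s. \<Sum>j\<in>UNIV. a j s * (E j (\<gamma> s) d $ i)) has_real_derivative
        (\<Sum>j\<in>UNIV. a' j * (E j ?p d $ i) + a j t * D j i)) (at t)"
      by (auto intro!: derivative_eq_intros a Ej sum.cong)
    then show "((\<lambda>s. Z s d $ i) has_real_derivative
        (\<Sum>j\<in>UNIV. a' j * (E j ?p d $ i) + a j t * D j i)) (at t)"
      by (rule has_field_derivative_transform_within_open[OF _ open_curve_preimage[OF \<gamma>(1) V(1)]])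
        (use \<gamma> V in \<open>auto simp: Z sum_fun_apply scaleR_fun_apply\<close>)
  qed
  moreover have "Z t d $ i = (\<Sum>j\<in>UNIV. a j t * (E j ?p d $ i))" for i
    using Z[OF \<gamma>(2) V(2)] by (simp add: sum_fun_apply scaleR_fun_apply)
  ultimately have "nabla_along \<gamma> Z t =
      (\<Sum>i\<in>UNIV. \<Sum>j\<in>UNIV. (a' j * (E j ?p d $ i)) *\<^sub>R coord_field d i ?p +
        a j t *\<^sub>R (D j i *\<^sub>R coord_field d i ?p + (E j ?p d $ i) *\<^sub>R nabla ?p ?v (coord_field d i)))"
    unfolding nabla_along_def Let_def d_def[symmetric]
    by (simp add: scaleR_left.sum sum.distrib[symmetric] scaleR_add_left scaleR_add_right add.assoc)
  also have "\<dots> = (\<Sum>j\<in>UNIV. a' j *\<^sub>R (\<Sum>i\<in>UNIV. (E j ?p d $ i) *\<^sub>R coord_field d i ?p) +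
      a j t *\<^sub>R (\<Sum>i\<in>UNIV. D j i *\<^sub>R coord_field d i ?p +
        (E j ?p d $ i) *\<^sub>R nabla ?p ?v (coord_field d i)))"
    by (subst sum.swap) (simp add: scaleR_sum_right scaleR_add_right sum.distrib)
  also have "\<dots> = (\<Sum>j\<in>UNIV. a' j *\<^sub>R E j ?p + a j t *\<^sub>R nabla ?p ?v (E j))"
    using coord_field_expansion[OF d smooth_vfield_tangent[OF E V(2)]]
      nabla_chart[OF V velocity_in_tangent[OF \<gamma>] E d]
    by (simp add: D_def)
  finally show ?thesis .
qed

end

section \<open>Parseval frames, horizontal projection and horizontal gradient\<close>

context sub_riemannian_manifold
begin

lemma horizontal_subspace: "p \<in> topspace M \<Longrightarrow> subspace (\<Sigma> p)"
  using distribution by blast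

lemma horizontal_tangent: "p \<in> topspace M \<Longrightarrow> v \<in> \<Sigma> p \<Longrightarrow> v \<in> tangent p"
  using distribution by blast

text \<open>Parseval families generalise orthonormal bases: the entries may be linearly dependent or zero, so one
  fixed index type serves for subspaces of every dimension up to that of the
  manifold.\<close>

definition parseval_on :: "'a \<Rightarrow> ('a, 'm) tvec set \<Rightarrow> ('m \<Rightarrow> ('a, 'm) tvec) \<Rightarrow> bool" where
  "parseval_on p S F \<longleftrightarrow> (\<forall>j. F j \<in> S) \<and> (\<forall>u\<in>S. (\<Sum>j\<in>UNIV. g p u (F j) *\<^sub>R F j) = u)"

text \<open>The expansion operator of a Parseval family is self-adjoint and fixes the subspace, so it
  is the orthogonal projection onto it.\<close>

lemma metric_parseval_projection:
  assumes p: "p \<in> topspace M" and F: "parseval_on p S F" and S: "S \<subseteq> tangent p"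
    and "v \<in> tangent p" "u \<in> S"
  shows "g p (\<Sum>j\<in>UNIV. g p v (F j) *\<^sub>R F j) u = g p v u"
proof -
  have u: "u \<in> tangent p" using S assms(5) by blast
  have Fj: "F j \<in> tangent p" for j using F S by (auto simp: parseval_on_def)
  have "g p (\<Sum>j\<in>UNIV. g p v (F j) *\<^sub>R F j) u = (\<Sum>j\<in>UNIV. g p v (F j) * g p u (F j))"
    using metric_sym[OF p u Fj] by (simp add: metric_sum_left[OF p u Fj])
  also have "\<dots> = g p v (\<Sum>j\<in>UNIV. g p u (F j) *\<^sub>R F j)"
    by (simp add: metric_sum_right[OF p assms(4) Fj] mult.commute)
  also have "\<dots> = g p v u"
    using F assms(5) by (simp add: parseval_on_def)
  finally show ?thesis .
qed

text \<open>The pointwise Gram--Schmidt step.  The new normalised vector takes the place of a zero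
  entry, so the index type stays the same.\<close>

lemma parseval_on_extend:
  assumes p: "p \<in> topspace M" and S: "subspace S" "S \<subseteq> tangent p" and F: "parseval_on p S F"
    and T: "subspace T" "S \<subseteq> T" "\<And>u. u \<in> T \<Longrightarrow> \<exists>c. u - c *\<^sub>R e \<in> S"
    and e: "e \<in> T" "e \<in> tangent p" "e \<notin> S" and j0: "F j0 = 0"
    and w: "w = e + (-1) *\<^sub>R (\<Sum>j\<in>UNIV. g p e (F j) *\<^sub>R F j)"
  shows "0 < g p w w" "parseval_on p T (F(j0 := (g p w w powr (- 1/2)) *\<^sub>R w))"
proof -
  define P where "P u = (\<Sum>j\<in>UNIV. g p u (F j) *\<^sub>R F j)" for u
  have w': "w = e - P e" by (simp add: w P_def)
  have FS: "F j \<in> S" for j using F by (simp add: parseval_on_def)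
  have PS: "P u \<in> S" for u
    unfolding P_def by (intro subspace_sum subspace_scale S FS)
  have wT: "w \<in> T" "w \<in> tangent p"
    using subspace_diff[OF T(1) e(1), of "P e"] subspace_diff[OF subspace_tangent e(2), of "P e"] PS T(2) S(2)
    by (auto simp: w')
  have "w \<noteq> 0" using PS[of e] e(3) by (auto simp: w')
  then show pos: "0 < g p w w" using metric_pos p wT by blast
  have perp: "g p w u = 0" if "u \<in> S" for u
  proof -
    have "g p w u = g p e u - g p (P e) u"
      unfolding w' using PS that S(2) e(2) by (intro metric_diff p) auto
    then show ?thesis
      using metric_parseval_projection[OF p F S(2) e(2) that] by (simp add: P_def)
  qed
  define r where "r = g p w w powr (- 1/2)"
  have r: "r * r * g p w w = 1"
  proof -
    have "r * r = g p w w powr (-1)" unfolding r_def powr_add[symmetric] by simp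
    then show ?thesis using pos by (simp add: powr_minus)
  qed
  define F' where "F' = F(j0 := r *\<^sub>R w)"
  have expand: "(\<Sum>j\<in>UNIV. g p u (F' j) *\<^sub>R F' j) = P u + g p u (r *\<^sub>R w) *\<^sub>R r *\<^sub>R w" for u
  proof -
    have "(\<Sum>j\<in>UNIV. g p u (F' j) *\<^sub>R F' j)
        = g p u (F' j0) *\<^sub>R F' j0 + (\<Sum>j\<in>UNIV - {j0}. g p u (F' j) *\<^sub>R F' j)"
      by (rule sum.remove) auto
    also have "(\<Sum>j\<in>UNIV - {j0}. g p u (F' j) *\<^sub>R F' j) = (\<Sum>j\<in>UNIV - {j0}. g p u (F j) *\<^sub>R F j)"
      by (rule sum.cong) (auto simp: F'_def)
    also have "\<dots> = P u"
      unfolding P_def by (rule sum.mono_neutral_left) (auto simp: j0)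
    also have "g p u (F' j0) *\<^sub>R F' j0 + P u = P u + g p u (F' j0) *\<^sub>R F' j0"
      by (rule add.commute)
    finally show ?thesis by (simp only: F'_def fun_upd_same)
  qed
  have "(\<Sum>j\<in>UNIV. g p u (F' j) *\<^sub>R F' j) = u" if u: "u \<in> T" for u
  proof -
    obtain c where c: "u - c *\<^sub>R e \<in> S" using T(3)[OF u] by blast
    \<comment> \<open>Replacing \<open>e\<close> by its component orthogonal to \<open>S\<close> in the decomposition of \<open>u\<close>.\<close>
    define s where "s = (u - c *\<^sub>R e) + c *\<^sub>R P e"
    have s: "s \<in> S" unfolding s_def by (intro subspace_add subspace_scale S c PS)
    then have st: "s \<in> tangent p" using S(2) by blast
    have us: "u = s + c *\<^sub>R w" by (simp add: s_def w' scaleR_diff_right)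
    have cw: "c *\<^sub>R w \<in> tangent p" by (intro subspace_scale[OF subspace_tangent] wT)
    have gu: "g p u y = g p s y + c * g p w y" if "y \<in> tangent p" for y
      using metric_add[OF p st cw that] metric_scale[OF p wT(2) that] us by simp
    have "g p u (F j) = g p s (F j)" for j
      using gu[of "F j"] perp[OF FS] FS S(2) by auto
    then have "P u = s" using F s by (simp add: P_def parseval_on_def)
    moreover have "g p u (r *\<^sub>R w) * r = c"
    proof -
      have "g p u (r *\<^sub>R w) = r * g p u w"
        using metric_sym[OF p] metric_scale[OF p wT(2)] us
          subspace_add[OF subspace_tangent st cw] subspace_scale[OF subspace_tangent wT(2)] wT(2)
        by metis
      moreover have "g p u w = c * g p w w"
        using gu[OF wT(2)] perp[OF s] metric_sym[OF p st wT(2)] by simp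
      ultimately show ?thesis using r by (simp add: mult_ac)
    qed
    ultimately show ?thesis using us by (simp add: expand)
  qed
  moreover have "F' j \<in> T" for j
    using FS T(2) subspace_scale[OF T(1) wT(1)] by (auto simp: F'_def)
  ultimately show "parseval_on p T (F(j0 := (g p w w powr (- 1/2)) *\<^sub>R w))"
    by (simp add: parseval_on_def F'_def r_def)
qed

text \<open>Gram--Schmidt applied at all points of \<open>V\<close> simultaneously.  The fields outside \<open>J\<close> vanish, which keeps
  room for the following steps.\<close>

lemma gram_schmidt:
  assumes V: "openin M V" and E: "\<And>i. i < k \<Longrightarrow> smooth_vfield V (E i)"
    and ind: "\<And>q. q \<in> V \<Longrightarrow> inj_on (\<lambda>i. E i q) {..<k} \<and> independent ((\<lambda>i. E i q) ` {..<k})"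
    and n: "n \<le> k"
  shows "\<exists>(F :: 'm \<Rightarrow> ('a, 'm) vfield) J. card J = n \<and> (\<forall>j. smooth_vfield V (F j)) \<and>
    (\<forall>j. j \<notin> J \<longrightarrow> F j = (\<lambda>q. 0)) \<and>
    (\<forall>q\<in>V. parseval_on q (span ((\<lambda>i. E i q) ` {..<n})) (\<lambda>j. F j q))"
  using n
proof (induction n)
  case 0
  have "parseval_on q (span ((\<lambda>i. E i q) ` {..<0})) (\<lambda>j. 0)" for q
    unfolding parseval_on_def
    by (simp only: lessThan_0 image_empty span_empty ball_simps scaleR_zero_right sum.neutral_const) simp
  then show ?case
    using smooth_vfield_zero card.empty by (intro exI[of _ "\<lambda>j q. 0"] exI[of _ "{}"]) blast
next
  case (Suc n)
  from Suc.IH[OF Suc_leD[OF Suc.prems]]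
  obtain F :: "'m \<Rightarrow> ('a, 'm) vfield" and J where J: "card J = n"
    and F: "\<And>j. smooth_vfield V (F j)" "\<And>j. j \<notin> J \<Longrightarrow> F j = (\<lambda>q. 0)"
    and parseval: "\<And>q. q \<in> V \<Longrightarrow> parseval_on q (span ((\<lambda>i. E i q) ` {..<n})) (\<lambda>j. F j q)"
    by blast
  \<comment> \<open>The rank is below the dimension, so an unused index is left.\<close>
  have "J \<noteq> UNIV" using J Suc.prems rank_less by auto
  then obtain j0 where j0: "j0 \<notin> J" by blast
  have En: "smooth_vfield V (E n)" using E Suc.prems by simp
  define w where "w q = E n q + (-1) *\<^sub>R (\<Sum>j\<in>UNIV. g q (E n q) (F j q) *\<^sub>R F j q)" for q
  define h where "h q = g q (w q) (w q)" for q
  define F' where "F' = F(j0 := (\<lambda>q. (h q powr (- 1/2)) *\<^sub>R w q))"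
  have step: "0 < h q" "parseval_on q (span ((\<lambda>i. E i q) ` {..<Suc n})) (\<lambda>j. F' j q)" if q: "q \<in> V" for q
  proof -
    let ?S = "span ((\<lambda>i. E i q) ` {..<n})" and ?T = "span ((\<lambda>i. E i q) ` {..<Suc n})"
    have p: "q \<in> topspace M" using q openin_subset[OF V] by blast
    have Et: "E i q \<in> tangent q" if "i < k" for i
      using smooth_vfield_tangent[OF E[OF that] q] .
    have img: "(\<lambda>i. E i q) ` {..<Suc n} = insert (E n q) ((\<lambda>i. E i q) ` {..<n})"
      by (auto simp: lessThan_Suc)
    have St: "?S \<subseteq> tangent q"
      using Et Suc.prems by (intro span_minimal subspace_tangent) auto
    have "E n q \<notin> ?S"
    proof
      assume "E n q \<in> ?S"
      moreover have "(\<lambda>i. E i q) ` {..<n} \<subseteq> (\<lambda>i. E i q) ` {..<k} - {E n q}"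
        using ind[OF q] Suc.prems by (auto dest: inj_onD)
      ultimately have "E n q \<in> span ((\<lambda>i. E i q) ` {..<k} - {E n q})"
        using span_mono by blast
      then show False using ind[OF q] Suc.prems by (auto simp: dependent_def)
    qed
    have T: "?S \<subseteq> ?T" "E n q \<in> ?T"
      unfolding img by (auto intro: span_mono[THEN subsetD] span_base)
    have br: "\<exists>c. u - c *\<^sub>R E n q \<in> ?S" if "u \<in> ?T" for u
      using that unfolding img span_insert by blast
    have Fj0: "F j0 q = 0" using F(2)[OF j0] by simp
    show "0 < h q"
      unfolding h_def
      using parseval_on_extend(1)[OF p subspace_span St parseval[OF q] subspace_span T(1) br T(2)
          Et[of n] \<open>E n q \<notin> ?S\<close> Fj0 w_def] Suc.prems by simp
    have "(\<lambda>j. F' j q) = (\<lambda>j. F j q)(j0 := (g q (w q) (w q) powr (- 1/2)) *\<^sub>R w q)"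
      by (auto simp: F'_def h_def fun_eq_iff)
    then show "parseval_on q ?T (\<lambda>j. F' j q)"
      using parseval_on_extend(2)[OF p subspace_span St parseval[OF q] subspace_span T(1) br T(2)
          Et[of n] \<open>E n q \<notin> ?S\<close> Fj0 w_def] Suc.prems by simp
  qed
  have w: "smooth_vfield V w"
    unfolding w_def
    by (intro smooth_vfield_add smooth_vfield_scale smooth_vfield_sum smooth_fun_const metric_smooth V En F)
  have "smooth_fun V (\<lambda>q. h q powr (- 1/2))"
    by (rule smooth_fun_powr[OF V _ step(1)]) (simp_all add: h_def metric_smooth[OF V w w])
  then have "smooth_vfield V (F' j)" for j
    using F(1) smooth_vfield_scale[OF V _ w] by (simp add: F'_def)
  moreover have "card (insert j0 J) = Suc n" using J j0 by simp
  moreover have "F' j = (\<lambda>q. 0)" if "j \<notin> insert j0 J" for j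
    using that F(2) by (simp add: F'_def)
  ultimately show ?case using step(2) by blast
qed

definition horizontal_frame :: "'a set \<Rightarrow> ('m \<Rightarrow> ('a, 'm) vfield) \<Rightarrow> bool" where
  "horizontal_frame V E \<longleftrightarrow> openin M V \<and> (\<forall>j. smooth_vfield V (E j)) \<and>
    (\<forall>q\<in>V. parseval_on q (\<Sigma> q) (\<lambda>j. E j q))"

lemma horizontal_frame_exists:
  assumes "p \<in> topspace M"
  obtains V E where "horizontal_frame V E" "p \<in> V"
proof -
  obtain V and E :: "nat \<Rightarrow> ('a, 'm) vfield" where V: "openin M V" "p \<in> V"
    and E: "\<And>i. i < k \<Longrightarrow> smooth_vfield V (E i)"
    and ind: "\<And>q. q \<in> V \<Longrightarrow> inj_on (\<lambda>i. E i q) {..<k} \<and> independent ((\<lambda>i. E i q) ` {..<k})"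
    and span: "\<And>q. q \<in> V \<Longrightarrow> span ((\<lambda>i. E i q) ` {..<k}) = \<Sigma> q"
    using local_frame[OF assms] by blast
  obtain F :: "'m \<Rightarrow> ('a, 'm) vfield" where "\<And>j. smooth_vfield V (F j)"
    "\<And>q. q \<in> V \<Longrightarrow> parseval_on q (span ((\<lambda>i. E i q) ` {..<k})) (\<lambda>j. F j q)"
    using gram_schmidt[of V E k, OF V(1) E ind] by auto
  then show thesis
    using that[of V F] V span by (simp add: horizontal_frame_def)
qed

lemma horizontal_frameD:
  assumes "horizontal_frame V E"
  shows "openin M V" "smooth_vfield V (E j)" "q \<in> V \<Longrightarrow> q \<in> topspace M"
    "q \<in> V \<Longrightarrow> parseval_on q (\<Sigma> q) (\<lambda>j. E j q)" "q \<in> V \<Longrightarrow> E j q \<in> \<Sigma> q"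
    "q \<in> V \<Longrightarrow> u \<in> \<Sigma> q \<Longrightarrow> (\<Sum>j\<in>UNIV. g q u (E j q) *\<^sub>R E j q) = u"
  using assms openin_subset by (auto simp: horizontal_frame_def parseval_on_def)

text \<open>The difference of the two vectors lies in \<open>\<Sigma>\<close> and is orthogonal to itself.\<close>

lemma horizontal_eqI:
  assumes p: "p \<in> topspace M" and w: "w \<in> \<Sigma> p" "w' \<in> \<Sigma> p"
    and eq: "\<And>u. u \<in> \<Sigma> p \<Longrightarrow> g p u w = g p u w'"
  shows "w = w'"
proof -
  have d: "w - w' \<in> \<Sigma> p" by (rule subspace_diff[OF horizontal_subspace[OF p] w])
  note t = horizontal_tangent[OF p]
  have "g p (w - w') (w - w') = g p w (w - w') - g p w' (w - w')"
    by (rule metric_diff[OF p t[OF w(1)] t[OF w(2)] t[OF d]])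
  also have "\<dots> = 0"
    using eq[OF d] metric_sym[OF p t[OF d] t[OF w(1)]] metric_sym[OF p t[OF d] t[OF w(2)]] by simp
  finally show ?thesis using metric_eq_0D[OF p t[OF d]] by simp
qed

lemma hproj_eqI:
  assumes p: "p \<in> topspace M" and v: "v \<in> tangent p" and w: "w \<in> \<Sigma> p"
    and eq: "\<And>u. u \<in> \<Sigma> p \<Longrightarrow> g p w u = g p v u"
  shows "hproj p v = w"
  unfolding hproj_def
proof (rule the_equality)
  note t = horizontal_tangent[OF p]
  show "w \<in> \<Sigma> p \<and> (\<forall>u\<in>\<Sigma> p. g p (v - w) u = 0)"
    using w eq metric_diff[OF p v t[OF w] t] by simp
  fix w' assume w': "w' \<in> \<Sigma> p \<and> (\<forall>u\<in>\<Sigma> p. g p (v - w') u = 0)"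
  show "w' = w"
  proof (rule horizontal_eqI[OF p _ w])
    fix u assume u: "u \<in> \<Sigma> p"
    then have "g p w' u = g p w u"
      using w' eq[OF u] metric_diff[OF p v t[of w'] t[OF u]] by simp
    then show "g p u w' = g p u w"
      using metric_sym[OF p t[OF u] t] w w' by simp
  qed (use w' in simp)
qed

lemma hproj_frame:
  assumes E: "horizontal_frame V E" and q: "q \<in> V" and v: "v \<in> tangent q"
  shows "hproj q v = (\<Sum>j\<in>UNIV. g q v (E j q) *\<^sub>R E j q)"
proof -
  note p = horizontal_frameD(3)[OF E q]
  show ?thesis
  proof (rule hproj_eqI[OF p v])
    show "(\<Sum>j\<in>UNIV. g q v (E j q) *\<^sub>R E j q) \<in> \<Sigma> q"
      by (intro subspace_sum subspace_scale horizontal_subspace p horizontal_frameD(5)[OF E q])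
    show "g q (\<Sum>j\<in>UNIV. g q v (E j q) *\<^sub>R E j q) u = g q v u" if "u \<in> \<Sigma> q" for u
      using horizontal_tangent[OF p] horizontal_frameD(4)[OF E q] v that
      by (intro metric_parseval_projection[of q "\<Sigma> q"] p) auto
  qed
qed

lemma hproj_orthogonal:
  assumes p: "p \<in> topspace M" and v: "v \<in> tangent p"
  shows "hproj p v \<in> \<Sigma> p" "u \<in> \<Sigma> p \<Longrightarrow> g p (hproj p v) u = g p v u"
proof -
  obtain V E where E: "horizontal_frame V E" "p \<in> V" using horizontal_frame_exists[OF p] .
  show "hproj p v \<in> \<Sigma> p"
    unfolding hproj_frame[OF E v]
    by (intro subspace_sum subspace_scale horizontal_subspace p horizontal_frameD(5)[OF E])
  show "g p (hproj p v) u = g p v u" if "u \<in> \<Sigma> p"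
    unfolding hproj_frame[OF E v]
    using horizontal_tangent[OF p] horizontal_frameD(4)[OF E] v that
    by (intro metric_parseval_projection[of p "\<Sigma> p"] p) auto
qed

context
  fixes f :: "'a \<Rightarrow> real"
  assumes f: "smooth_fun (topspace M) f"
begin

text \<open>The gradient is the Riesz representative of \<open>df\<close> on \<open>\<Sigma>\<close>, which a Parseval family computes without
  inverting a Gram matrix; its smooth dependence on the point is then visible from the formula.\<close>

lemma hgrad_frame:
  assumes E: "horizontal_frame V E" and q: "q \<in> V"
  shows "hgrad f q = (\<Sum>j\<in>UNIV. differential f q (E j q) *\<^sub>R E j q)" (is "_ = ?G")
    and "v \<in> \<Sigma> q \<Longrightarrow> g q v (hgrad f q) = differential f q v"
proof -
  note p = horizontal_frameD(3)[OF E q]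
  note t = horizontal_tangent[OF p]
  note Et = t[OF horizontal_frameD(5)[OF E q]]
  have G: "?G \<in> \<Sigma> q"
    by (intro subspace_sum subspace_scale horizontal_subspace p horizontal_frameD(5)[OF E q])
  have lin: "linear (differential f q)"
    by (rule linear_differential[OF openin_topspace f p])
  have gG: "g q v ?G = differential f q v" if v: "v \<in> \<Sigma> q" for v
  proof -
    have "g q v ?G = (\<Sum>j\<in>UNIV. differential f q (E j q) * g q v (E j q))"
      by (rule metric_sum_right[OF p t[OF v] Et])
    also have "\<dots> = differential f q (\<Sum>j\<in>UNIV. g q v (E j q) *\<^sub>R E j q)"
      by (simp add: linear_sum[OF lin] linear_cmul[OF lin] mult.commute)
    finally show ?thesis by (simp add: horizontal_frameD(6)[OF E q v])
  qed
  show eq: "hgrad f q = ?G"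
    unfolding hgrad_def
  proof (rule the_equality)
    fix w assume "w \<in> \<Sigma> q \<and> (\<forall>v\<in>\<Sigma> q. g q v w = differential f q v)"
    then show "w = ?G" using gG by (intro horizontal_eqI[OF p _ G]) auto
  qed (use G gG in auto)
  show "g q v (hgrad f q) = differential f q v" if "v \<in> \<Sigma> q"
    unfolding eq by (rule gG[OF that])
qed

lemma hgrad_horizontal:
  assumes "p \<in> topspace M"
  shows "hgrad f p \<in> \<Sigma> p" "v \<in> \<Sigma> p \<Longrightarrow> g p v (hgrad f p) = differential f p v"
proof -
  obtain V E where E: "horizontal_frame V E" "p \<in> V" using horizontal_frame_exists[OF assms] .
  show "hgrad f p \<in> \<Sigma> p"
    unfolding hgrad_frame(1)[OF E]
    by (intro subspace_sum subspace_scale horizontal_subspace assms horizontal_frameD(5)[OF E])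
  show "v \<in> \<Sigma> p \<Longrightarrow> g p v (hgrad f p) = differential f p v"
    by (rule hgrad_frame(2)[OF E])
qed

lemma smooth_vfield_hgrad:
  assumes E: "horizontal_frame V E"
  shows "smooth_vfield V (hgrad f)"
proof -
  note V = horizontal_frameD(1)[OF E]
  have "smooth_fun V f"
    by (rule smooth_fun_subset[OF f openin_subset[OF V]])
  then have "smooth_vfield V (\<lambda>q. \<Sum>j\<in>UNIV. differential f q (E j q) *\<^sub>R E j q)"
    by (intro smooth_vfield_sum smooth_vfield_scale smooth_fun_differential V horizontal_frameD(2)[OF E])
  then show ?thesis
    by (rule smooth_vfield_cong[OF V]) (simp add: hgrad_frame(1)[OF E])
qed

end

end

section \<open>The second derivative of a function along a geodesic\<close>

context riemannian_manifold
begin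

text \<open>The velocity is not the restriction of a vector field, so smoothness of the metric cannot be applied to it
  directly; its expansion in coordinate fields has smooth coefficients.\<close>

lemma differentiable_velocity_component:
  assumes \<gamma>: "smooth_curve I \<gamma>" "t \<in> I" and V: "openin M V" "\<gamma> t \<in> V" and Y: "smooth_vfield V Y"
  obtains a' where "((\<lambda>s. g (\<gamma> s) (velocity \<gamma> s) (Y (\<gamma> s))) has_real_derivative a') (at t)"
proof -
  define d where "d = chart_of (\<gamma> t)"
  have "d \<in> charts_at (\<gamma> t)"
    unfolding d_def using curve_in_topspace[OF \<gamma>] by (rule chart_of_in)
  then have d: "d \<in> A" "\<gamma> t \<in> fst d" by (auto simp: charts_at_def)
  define W where "W = V \<inter> fst d"
  have W: "openin M W" "\<gamma> t \<in> W" "W \<subseteq> V" "W \<subseteq> fst d"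
    using openin_Int[OF V(1) openin_chart[OF d(1)]] V(2) d(2) by (auto simp: W_def)
  define h where "h i = (\<lambda>q. g q (coord_field d i q) (Y q))" for i
  have h: "smooth_fun W (h i)" for i
    unfolding h_def
    by (intro metric_smooth W smooth_vfield_subset[OF Y] smooth_vfield_subset[OF smooth_vfield_coord_field] d)
  let ?S = "{s \<in> I. \<gamma> s \<in> fst d}"
  let ?u = "\<lambda>s. frechet_derivative (snd d \<circ> \<gamma>) (at s) 1"
  have "?u differentiable at t"
    using smooth_on_has_derivative[OF smooth_on_directional_derivative[OF smooth_on_chart_curve[OF \<gamma>(1) d(1)]], of t 1]
      \<gamma>(2) d(2) by (auto simp: differentiable_def)
  then obtain u' where u': "(?u has_vector_derivative u') (at t)"
    by (auto simp: vector_derivative_works)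
  have ui: "((\<lambda>s. ?u s $ i) has_real_derivative u' $ i) (at t)" for i
    unfolding has_real_derivative_iff_has_vector_derivative
    by (rule bounded_linear.has_vector_derivative[OF bounded_linear_vec_nth u'])
  have hi: "((\<lambda>s. h i (\<gamma> s)) has_real_derivative differential (h i) (\<gamma> t) (velocity \<gamma> t)) (at t)" for i
    using has_vector_derivative_along_curve[OF \<gamma> W(1,2) h]
    by (simp add: has_real_derivative_iff_has_vector_derivative comp_def)
  have "((\<lambda>s. \<Sum>i\<in>UNIV. (?u s $ i) * h i (\<gamma> s)) has_real_derivative
      (\<Sum>i\<in>UNIV. (u' $ i) * h i (\<gamma> t) + differential (h i) (\<gamma> t) (velocity \<gamma> t) * (?u t $ i))) (at t)"
    by (intro DERIV_sum DERIV_mult ui hi)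
  then have "((\<lambda>s. g (\<gamma> s) (velocity \<gamma> s) (Y (\<gamma> s))) has_real_derivative
      (\<Sum>i\<in>UNIV. (u' $ i) * h i (\<gamma> t) + differential (h i) (\<gamma> t) (velocity \<gamma> t) * (?u t $ i))) (at t)"
  proof (rule has_field_derivative_transform_within_open)
    show "open {s \<in> I. \<gamma> s \<in> W}" by (rule open_curve_preimage[OF \<gamma>(1) W(1)])
    show "t \<in> {s \<in> I. \<gamma> s \<in> W}" using \<gamma> W by simp
    fix s assume "s \<in> {s \<in> I. \<gamma> s \<in> W}"
    then have s: "s \<in> I" "\<gamma> s \<in> W" by auto
    have ds: "d \<in> charts_at (\<gamma> s)" using s W d by (auto simp: charts_at_def)
    have vs: "velocity \<gamma> s \<in> tangent (\<gamma> s)" by (rule velocity_in_tangent[OF \<gamma>(1) s(1)])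
    have "?u s = velocity \<gamma> s d"
      using frechet_derivative_at[OF velocity_has_vector_derivative[OF \<gamma>(1) s(1) ds,
            unfolded has_vector_derivative_def]]
      by (metis scaleR_one)
    moreover have "g (\<gamma> s) (velocity \<gamma> s) (Y (\<gamma> s)) =
        g (\<gamma> s) (\<Sum>i\<in>UNIV. (velocity \<gamma> s d $ i) *\<^sub>R coord_field d i (\<gamma> s)) (Y (\<gamma> s))"
      by (simp only: coord_field_expansion[OF ds vs])
    moreover have "\<dots> = (\<Sum>i\<in>UNIV. (velocity \<gamma> s d $ i) * h i (\<gamma> s))"
      unfolding h_def using s W
      by (intro metric_sum_left curve_in_topspace[OF \<gamma>(1)] smooth_vfield_tangent[OF Y]
          smooth_vfield_tangent[OF smooth_vfield_coord_field[OF d(1)]]) auto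
    ultimately show "(\<Sum>i\<in>UNIV. (?u s $ i) * h i (\<gamma> s)) = g (\<gamma> s) (velocity \<gamma> s) (Y (\<gamma> s))"
      by simp
  qed
  then show thesis by (rule that)
qed

end

context sub_riemannian_manifold
begin

lemma horizontal_curve_velocity:
  assumes "horizontal_curve I \<gamma>" "t \<in> I"
  shows "velocity \<gamma> t \<in> \<Sigma> (\<gamma> t)"
  using assms by (simp add: horizontal_curve_def)

lemma geodesic_curves:
  assumes "nonholonomic_geodesic I \<gamma>"
  shows "smooth_curve I \<gamma>" "horizontal_curve I \<gamma>"
  using assms by (simp_all add: nonholonomic_geodesic_def horizontal_curve_def)

context
  fixes f :: "'a \<Rightarrow> real"
  assumes f: "smooth_fun (topspace M) f"
begin

lemma derivative_along_horizontal_curve: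
  assumes \<gamma>: "horizontal_curve I \<gamma>" "t \<in> I"
  shows "((f \<circ> \<gamma>) has_real_derivative g (\<gamma> t) (velocity \<gamma> t) (hgrad f (\<gamma> t))) (at t)"
proof -
  have sc: "smooth_curve I \<gamma>" using \<gamma> by (simp add: horizontal_curve_def)
  have p: "\<gamma> t \<in> topspace M" by (rule curve_in_topspace[OF sc \<gamma>(2)])
  show ?thesis
    using has_vector_derivative_along_curve[OF sc \<gamma>(2) openin_topspace p f]
      hgrad_horizontal(2)[OF f p horizontal_curve_velocity[OF \<gamma>]]
    by (simp add: has_real_derivative_iff_has_vector_derivative)
qed

text \<open>Differentiating \<open>g(\<gamma>', \<nabla>\<^sup>H f)\<close> by metric compatibility gives
  \<open>g(\<nabla>\<^bsub>\<gamma>'\<^esub> \<gamma>', \<nabla>\<^sup>H f) + g(\<gamma>', \<nabla>\<^bsub>\<gamma>'\<^esub> \<nabla>\<^sup>H f)\<close>.  The first term vanishes because the covariant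
  acceleration of a geodesic is orthogonal to \<open>\<Sigma>\<close> whereas the horizontal gradient lies in
  \<open>\<Sigma>\<close>; the second one is the horizontal Hessian because \<open>\<gamma>'\<close> is horizontal.  Since \<open>\<gamma>'\<close> is defined
  only along the curve, metric compatibility is applied to the fields of a frame.\<close>

lemma second_derivative_along_geodesic:
  assumes \<gamma>: "nonholonomic_geodesic I \<gamma>" "t \<in> I"
  shows "((\<lambda>s. g (\<gamma> s) (velocity \<gamma> s) (hgrad f (\<gamma> s))) has_real_derivative
    hHess f (\<gamma> t) (velocity \<gamma> t) (velocity \<gamma> t)) (at t)"
proof -
  note sc = geodesic_curves(1)[OF \<gamma>(1)] and hc = geodesic_curves(2)[OF \<gamma>(1)]
  let ?p = "\<gamma> t" and ?v = "velocity \<gamma> t"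
  have p: "?p \<in> topspace M" by (rule curve_in_topspace[OF sc \<gamma>(2)])
  have v: "?v \<in> \<Sigma> ?p" "?v \<in> tangent ?p"
    using horizontal_curve_velocity[OF hc \<gamma>(2)] velocity_in_tangent[OF sc \<gamma>(2)] .
  obtain V E where E: "horizontal_frame V E" and pV: "?p \<in> V"
    using horizontal_frame_exists[OF p] .
  note V = horizontal_frameD(1)[OF E] and sE = horizontal_frameD(2)[OF E]
  note Et = smooth_vfield_tangent[OF sE]
  have sG: "smooth_vfield V (hgrad f)" by (rule smooth_vfield_hgrad[OF f E])
  note Gt = smooth_vfield_tangent[OF sG]
  note nt = nabla_tangent[OF V pV v(2)]
  define a where "a j s = g (\<gamma> s) (velocity \<gamma> s) (E j (\<gamma> s))" for j s
  have "\<exists>a'. (a j has_real_derivative a') (at t)" for j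
    using differentiable_velocity_component[OF sc \<gamma>(2) V pV sE, of j] unfolding a_def by metis
  then obtain a' where a': "\<And>j. (a j has_real_derivative a' j) (at t)" by metis
  have vel: "velocity \<gamma> s = (\<Sum>j\<in>UNIV. a j s *\<^sub>R E j (\<gamma> s))" if "s \<in> I" "\<gamma> s \<in> V" for s
    unfolding a_def
    by (rule horizontal_frameD(6)[OF E that(2) horizontal_curve_velocity[OF hc that(1)], symmetric])
  have acc: "nabla_along \<gamma> (velocity \<gamma>) t = (\<Sum>j\<in>UNIV. a' j *\<^sub>R E j ?p + a j t *\<^sub>R nabla ?p ?v (E j))"
    by (rule nabla_along_frame[OF sc \<gamma>(2) V pV sE a' vel])
  have tj: "a' j *\<^sub>R E j ?p \<in> tangent ?p" "a j t *\<^sub>R nabla ?p ?v (E j) \<in> tangent ?p" for j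
    by (intro subspace_scale[OF subspace_tangent] Et pV nt sE)+
  have acct: "nabla_along \<gamma> (velocity \<gamma>) t \<in> tangent ?p"
    unfolding acc by (intro subspace_sum subspace_add subspace_tangent tj)
  have "g ?p (nabla_along \<gamma> (velocity \<gamma>) t) (hgrad f ?p) = g ?p (hproj ?p (nabla_along \<gamma> (velocity \<gamma>) t)) (hgrad f ?p)"
    by (rule hproj_orthogonal(2)[OF p acct hgrad_horizontal(1)[OF f p], symmetric])
  also have "\<dots> = 0"
    using \<gamma> metric_zero_left[OF p Gt[OF pV]] by (simp add: nonholonomic_geodesic_def hnabla_along_def)
  finally have acc0: "g ?p (nabla_along \<gamma> (velocity \<gamma>) t) (hgrad f ?p) = 0" .
  have acc_sum: "g ?p (nabla_along \<gamma> (velocity \<gamma>) t) (hgrad f ?p) =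
      (\<Sum>j\<in>UNIV. a' j * g ?p (E j ?p) (hgrad f ?p) + a j t * g ?p (nabla ?p ?v (E j)) (hgrad f ?p))"
  proof -
    have "g ?p (nabla_along \<gamma> (velocity \<gamma>) t) (hgrad f ?p) =
        g ?p (\<Sum>j\<in>UNIV. 1 *\<^sub>R (a' j *\<^sub>R E j ?p + a j t *\<^sub>R nabla ?p ?v (E j))) (hgrad f ?p)"
      unfolding acc scaleR_one ..
    also have "\<dots> = (\<Sum>j\<in>UNIV. 1 * g ?p (a' j *\<^sub>R E j ?p + a j t *\<^sub>R nabla ?p ?v (E j)) (hgrad f ?p))"
      by (intro metric_sum_left p Gt pV subspace_add subspace_tangent tj)
    also have "\<dots> = (\<Sum>j\<in>UNIV. a' j * g ?p (E j ?p) (hgrad f ?p) + a j t * g ?p (nabla ?p ?v (E j)) (hgrad f ?p))"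
      unfolding mult_1
        metric_add[OF p tj Gt[OF pV]]
        metric_scale[OF p Et[OF pV] Gt[OF pV]] metric_scale[OF p nt[OF sE] Gt[OF pV]] ..
    finally show ?thesis .
  qed
  define h where "h j = (\<lambda>q. g q (E j q) (hgrad f q))" for j
  have "smooth_fun V (h j)" for j
    unfolding h_def by (rule metric_smooth[OF V sE sG])
  then have hj: "((\<lambda>s. h j (\<gamma> s)) has_real_derivative differential (h j) ?p ?v) (at t)" for j
    using has_vector_derivative_along_curve[OF sc \<gamma>(2) V pV, of "h j"]
    by (simp add: has_real_derivative_iff_has_vector_derivative comp_def)
  have "((\<lambda>s. \<Sum>j\<in>UNIV. a j s * h j (\<gamma> s)) has_real_derivative
      (\<Sum>j\<in>UNIV. a' j * h j ?p + differential (h j) ?p ?v * a j t)) (at t)"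
    by (intro DERIV_sum DERIV_mult a' hj)
  then have "((\<lambda>s. g (\<gamma> s) (velocity \<gamma> s) (hgrad f (\<gamma> s))) has_real_derivative
      (\<Sum>j\<in>UNIV. a' j * h j ?p + differential (h j) ?p ?v * a j t)) (at t)"
  proof (rule has_field_derivative_transform_within_open)
    show "open {s \<in> I. \<gamma> s \<in> V}" by (rule open_curve_preimage[OF sc V])
    show "t \<in> {s \<in> I. \<gamma> s \<in> V}" using \<gamma> pV by simp
    fix s assume "s \<in> {s \<in> I. \<gamma> s \<in> V}"
    then have s: "s \<in> I" "\<gamma> s \<in> V" by auto
    show "(\<Sum>j\<in>UNIV. a j s * h j (\<gamma> s)) = g (\<gamma> s) (velocity \<gamma> s) (hgrad f (\<gamma> s))"
      unfolding vel[OF s] h_def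
      by (rule metric_sum_left[symmetric, OF curve_in_topspace[OF sc s(1)] Gt[OF s(2)] Et[OF s(2)]])
  qed
  also have "(\<Sum>j\<in>UNIV. a' j * h j ?p + differential (h j) ?p ?v * a j t) =
      (\<Sum>j\<in>UNIV. a' j * g ?p (E j ?p) (hgrad f ?p) + a j t * g ?p (nabla ?p ?v (E j)) (hgrad f ?p)) +
      (\<Sum>j\<in>UNIV. a j t * g ?p (E j ?p) (nabla ?p ?v (hgrad f)))"
    by (simp add: h_def metric_compatible[OF V pV v(2) sE sG] sum.distrib[symmetric] algebra_simps)
  also have "\<dots> = (\<Sum>j\<in>UNIV. a j t * g ?p (E j ?p) (nabla ?p ?v (hgrad f)))"
    using acc0 acc_sum by simp
  also have "\<dots> = g ?p ?v (nabla ?p ?v (hgrad f))"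
    unfolding vel[OF \<gamma>(2) pV] metric_sum_left[OF p nt[OF sG, unfolded vel[OF \<gamma>(2) pV]] Et[OF pV]] ..
  also have "\<dots> = hHess f ?p ?v ?v"
    using hproj_orthogonal(2)[OF p nt[OF sG] v(1)] metric_sym[OF p v(2) nt[OF sG]]
    by (simp add: hHess_def hnabla_def)
  finally show ?thesis .
qed

end

section \<open>Geodesics with prescribed initial velocity\<close>

text \<open>Writing \<open>\<gamma>' = \<Sum>\<^sub>j a\<^sub>j E\<^sub>j\<close> in a Parseval frame, the geodesic equation follows from the first-order system
  \<open>\<gamma>' = \<Sum>\<^sub>j a\<^sub>j E\<^sub>j\<close>, \<open>a\<^sub>l' = - \<Sum>\<^sub>i\<^sub>j a\<^sub>i a\<^sub>j g(\<nabla>\<^bsub>E\<^sub>i\<^esub> E\<^sub>j, E\<^sub>l)\<close> for the point in a chart and the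
  coefficients.  Its first part makes the solution horizontal.  By its second part
  \<open>\<nabla>\<^bsub>\<gamma>'\<^esub> \<gamma>' = N - \<P> N\<close> for \<open>N = \<Sum>\<^sub>j a\<^sub>j \<nabla>\<^bsub>\<gamma>'\<^esub> E\<^sub>j\<close>, and \<open>\<P>\<close> kills this.\<close>

lemma geodesic_exists:
  assumes p: "p \<in> topspace M" and v: "v \<in> \<Sigma> p"
  obtains I \<gamma> where "nonholonomic_geodesic I \<gamma>" "0 \<in> I" "\<gamma> 0 = p" "velocity \<gamma> 0 = v"
proof -
  obtain V E where E: "horizontal_frame V E" and pV: "p \<in> V"
    using horizontal_frame_exists[OF p] .
  note V = horizontal_frameD(1)[OF E] and sE = horizontal_frameD(2)[OF E]
  note Et = smooth_vfield_tangent[OF sE]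
  define c where "c = chart_of p"
  have c: "c \<in> A" "p \<in> fst c"
    using chart_of_in[OF p] by (auto simp: c_def charts_at_def)
  define W where "W = snd c ` (fst c \<inter> V)"
  have W: "open W" unfolding W_def by (rule open_chart_image[OF c(1) V])
  define \<Gamma> where "\<Gamma> i j l = (\<lambda>q. g q (nabla q (E i q) (E j)) (E l q))" for i j l
  have s\<Gamma>: "smooth_fun V (\<Gamma> i j l)" for i j l
    unfolding \<Gamma>_def by (intro metric_smooth nabla_smooth V sE)
  let ?S = "W \<times> (UNIV :: (real ^ 'm) set)"
  define F :: "(real ^ 'm) \<times> (real ^ 'm) \<Rightarrow> (real ^ 'm) \<times> (real ^ 'm)" where
    "F z = (\<Sum>j\<in>UNIV. (snd z $ j) *\<^sub>R E j (chart_inv c (fst z)) c,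
      \<chi> l. \<Sum>i\<in>UNIV. \<Sum>j\<in>UNIV. (- 1) *\<^sub>R ((snd z $ i) * (snd z $ j)) * \<Gamma> i j l (chart_inv c (fst z)))" for z
  have S: "open ?S" using W by (intro open_Times) auto
  have smooth_fst: "smooth_on ?S (\<lambda>z. \<phi> (fst z))" if "smooth_on W \<phi>" for \<phi> :: "real ^ 'm \<Rightarrow> 'z::real_normed_vector"
    by (rule smooth_on_compose[OF S W smooth_on_linear[OF bounded_linear_fst S smooth_on_id] that]) auto
  have smooth_snd: "smooth_on ?S (\<lambda>z. snd z $ j)" for j
    by (rule smooth_on_linear[OF bounded_linear_compose[OF bounded_linear_vec_nth bounded_linear_snd] S smooth_on_id])
  have sF: "smooth_on ?S F"
    unfolding F_def
  proof (intro smooth_on_Pair smooth_on_vec_lambda smooth_on_sum smooth_on_scaleR smooth_on_mult S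
      smooth_snd smooth_fst smooth_on_const)
    show "smooth_on W (\<lambda>x. E j (chart_inv c x) c)" for j
      using sE[of j] c(1) by (simp add: smooth_vfield_def W_def)
    show "smooth_on W (\<lambda>x. \<Gamma> i j l (chart_inv c x))" for i j l
      using s\<Gamma>[of i j l] c(1) by (simp add: smooth_fun_def W_def comp_def)
  qed
  define z0 where "z0 = (snd c p, \<chi> j. g p v (E j p))"
  have "z0 \<in> ?S" using c pV by (auto simp: z0_def W_def)
  then obtain z e where z: "0 < e" "z 0 = z0" "\<And>t. t \<in> {-e<..<e} \<Longrightarrow> z t \<in> ?S" "smooth_on {-e<..<e} z"
    and ode: "\<And>t. t \<in> {-e<..<e} \<Longrightarrow> (z has_vector_derivative F (z t)) (at t)"
    using smooth_ode_local_solution[OF S sF] by metis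
  define I where "I = {-e<..<e}"
  define x where "x t = fst (z t)" for t
  define a where "a j t = snd (z t) $ j" for j t
  define \<gamma> where "\<gamma> = chart_inv c \<circ> x"
  have I: "open I" "is_interval I" by (auto simp: I_def is_interval_oo)
  have xW: "x t \<in> W" if "t \<in> I" for t
    using z(3)[of t] that by (auto simp: x_def I_def)
  have \<gamma>: "\<gamma> t \<in> V" "c \<in> charts_at (\<gamma> t)" "snd c (\<gamma> t) = x t" if "t \<in> I" for t
    using chart_inv_image[OF c(1), of "x t" V] xW[OF that] c(1)
    by (auto simp: \<gamma>_def W_def charts_at_def)
  have sx: "smooth_on I x"
    unfolding x_def I_def by (rule smooth_on_linear[OF bounded_linear_fst _ z(4)]) simp
  have sc: "smooth_curve I \<gamma>"
    unfolding \<gamma>_def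
    by (rule smooth_curve_of_chart[OF c(1) I sx]) (use xW W_def in blast)
  have x': "(x has_vector_derivative (\<Sum>j\<in>UNIV. a j t *\<^sub>R E j (\<gamma> t) c)) (at t)" if "t \<in> I" for t
    using bounded_linear.has_vector_derivative[OF bounded_linear_fst ode, of t] that
    by (simp add: x_def[abs_def] a_def[abs_def] \<gamma>_def F_def I_def comp_def)
  define a' where "a' l t = (\<Sum>i\<in>UNIV. \<Sum>j\<in>UNIV. - (a i t * a j t * \<Gamma> i j l (\<gamma> t)))" for l t
  have a': "(a l has_real_derivative a' l t) (at t)" if "t \<in> I" for l t
    using bounded_linear.has_vector_derivative[OF bounded_linear_compose[OF bounded_linear_vec_nth bounded_linear_snd] ode, of t l] that
    unfolding has_real_derivative_iff_has_vector_derivative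
    by (simp add: x_def[abs_def] a_def[abs_def] a'_def \<gamma>_def F_def I_def comp_def)
  have vel: "velocity \<gamma> t = (\<Sum>j\<in>UNIV. a j t *\<^sub>R E j (\<gamma> t))" if t: "t \<in> I" for t
  proof (rule tangent_eqI[OF velocity_in_tangent[OF sc t] _ \<gamma>(2)[OF t]])
    show "(\<Sum>j\<in>UNIV. a j t *\<^sub>R E j (\<gamma> t)) \<in> tangent (\<gamma> t)"
      by (intro tangent_sum Et \<gamma> t)
    have "(snd c \<circ> \<gamma> has_vector_derivative (\<Sum>j\<in>UNIV. a j t *\<^sub>R E j (\<gamma> t) c)) (at t)"
      by (rule has_vector_derivative_transform_within_open[OF x'[OF t] I(1) t]) (simp add: \<gamma>)
    then show "velocity \<gamma> t c = (\<Sum>j\<in>UNIV. a j t *\<^sub>R E j (\<gamma> t)) c"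
      using vector_derivative_unique_at[OF velocity_has_vector_derivative[OF sc t \<gamma>(2)[OF t]]]
      by (simp add: sum_fun_apply scaleR_fun_apply)
  qed
  have hor: "velocity \<gamma> t \<in> \<Sigma> (\<gamma> t)" if t: "t \<in> I" for t
    unfolding vel[OF t]
    by (intro subspace_sum subspace_scale horizontal_subspace horizontal_frameD(3)[OF E]
        horizontal_frameD(5)[OF E] \<gamma> t)
  have "hnabla_along \<gamma> (velocity \<gamma>) t = 0" if t: "t \<in> I" for t
  proof -
    let ?p = "\<gamma> t" and ?v = "velocity \<gamma> t"
    have pt: "?p \<in> topspace M" by (rule curve_in_topspace[OF sc t])
    note vt = velocity_in_tangent[OF sc t] and pV = \<gamma>(1)[OF t]
    note nt = nabla_tangent[OF V pV]
    define N where "N = (\<Sum>j\<in>UNIV. a j t *\<^sub>R nabla ?p ?v (E j))"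
    have N: "N \<in> tangent ?p"
      unfolding N_def by (intro tangent_sum nt vt sE)
    have gN: "g ?p N (E l ?p) = - a' l t" for l
    proof -
      have "g ?p N (E l ?p) = (\<Sum>j\<in>UNIV. a j t * g ?p (nabla ?p ?v (E j)) (E l ?p))"
        unfolding N_def by (intro metric_sum_left pt Et pV nt vt sE)
      also have "\<dots> = (\<Sum>j\<in>UNIV. a j t * (\<Sum>i\<in>UNIV. a i t * \<Gamma> i j l ?p))"
      proof (intro sum.cong refl arg_cong[of _ _ "(*) _"])
        fix j
        have "nabla ?p ?v (E j) = (\<Sum>i\<in>UNIV. a i t *\<^sub>R nabla ?p (E i ?p) (E j))"
          unfolding vel[OF t] by (intro nabla_sum_left[OF V pV] Et pV sE)
        then show "g ?p (nabla ?p ?v (E j)) (E l ?p) = (\<Sum>i\<in>UNIV. a i t * \<Gamma> i j l ?p)"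
          unfolding \<Gamma>_def by (simp only: metric_sum_left[OF pt Et[OF pV] nt[OF Et[OF pV] sE]])
      qed
      also have "\<dots> = (\<Sum>j\<in>UNIV. \<Sum>i\<in>UNIV. a i t * a j t * \<Gamma> i j l ?p)"
        by (simp add: sum_distrib_left mult_ac)
      also have "\<dots> = (\<Sum>i\<in>UNIV. \<Sum>j\<in>UNIV. a i t * a j t * \<Gamma> i j l ?p)"
        by (rule sum.swap)
      finally show ?thesis by (simp add: a'_def sum_negf)
    qed
    have "nabla_along \<gamma> (velocity \<gamma>) t = (\<Sum>j\<in>UNIV. a' j t *\<^sub>R E j ?p + a j t *\<^sub>R nabla ?p ?v (E j))"
      by (rule nabla_along_frame[OF sc t V pV sE a'[OF t] vel])
    also have "\<dots> = (\<Sum>j\<in>UNIV. a' j t *\<^sub>R E j ?p) + N"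
      unfolding N_def by (rule sum.distrib)
    also have "(\<Sum>j\<in>UNIV. a' j t *\<^sub>R E j ?p) = - hproj ?p N"
      unfolding hproj_frame[OF E pV N] gN scaleR_minus_left sum_negf minus_minus ..
    also have "- hproj ?p N + N = N - hproj ?p N"
      by (rule uminus_add_conv_diff)
    finally have acc: "nabla_along \<gamma> (velocity \<gamma>) t = N - hproj ?p N" .
    note hN = hproj_orthogonal[OF pt N]
    show ?thesis
      unfolding hnabla_along_def acc
    proof (rule hproj_eqI[OF pt])
      show "N - hproj ?p N \<in> tangent ?p"
        by (rule subspace_diff[OF subspace_tangent N horizontal_tangent[OF pt hN(1)]])
      show "0 \<in> \<Sigma> ?p" by (rule subspace_0[OF horizontal_subspace[OF pt]])
      show "g ?p 0 u = g ?p (N - hproj ?p N) u" if u: "u \<in> \<Sigma> ?p" for u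
        using metric_diff[OF pt N horizontal_tangent[OF pt hN(1)] horizontal_tangent[OF pt u]] hN(2)[OF u]
          metric_zero_left[OF pt horizontal_tangent[OF pt u]] by simp
    qed
  qed
  then have geo: "nonholonomic_geodesic I \<gamma>"
    using sc hor by (simp add: nonholonomic_geodesic_def horizontal_curve_def)
  have 0: "0 \<in> I" using z(1) by (simp add: I_def)
  have \<gamma>0: "\<gamma> 0 = p"
    using z(2) chart_inv_left[OF c] by (simp add: \<gamma>_def x_def z0_def)
  have "velocity \<gamma> 0 = (\<Sum>j\<in>UNIV. g p v (E j p) *\<^sub>R E j p)"
    unfolding vel[OF 0] \<gamma>0 by (simp add: a_def z(2) z0_def)
  then have "velocity \<gamma> 0 = v" using horizontal_frameD(6)[OF E pV v] by simp
  then show thesis by (rule that[OF geo 0 \<gamma>0])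
qed

end

section \<open>Convexity along geodesics\<close>

text \<open>If the derivative were decreasing at \<open>t\<close>, the tangents at \<open>t\<close> and at a slightly later point could
  not both lie below the graph.\<close>

lemma second_derivative_nonneg_of_convex_on:
  fixes \<phi> :: "real \<Rightarrow> real"
  assumes conv: "convex_on I \<phi>" and I: "open I" "t \<in> I"
    and d1: "\<And>s. s \<in> I \<Longrightarrow> (\<phi> has_real_derivative \<phi>' s) (at s)"
    and d2: "(\<phi>' has_real_derivative c) (at t)"
  shows "0 \<le> c"
proof (rule ccontr)
  assume "\<not> 0 \<le> c"
  then obtain d where d: "0 < d" "\<And>h. 0 < h \<Longrightarrow> h < d \<Longrightarrow> \<phi>' (t + h) < \<phi>' t"
    using DERIV_neg_dec_right[OF d2] by auto
  \<comment> \<open>The later point has to stay in \<open>I\<close> as well as in the range where \<open>\<phi>'\<close> lies below \<open>\<phi>' t\<close>.\<close>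
  obtain r where r: "0 < r" "ball t r \<subseteq> I" using I open_contains_ball by blast
  define s where "s = t + min d r / 2"
  have s: "s \<in> I" "t < s" "\<phi>' s < \<phi>' t"
    using d r d(2)[of "min d r / 2"] by (auto simp: s_def dist_norm)
  have tangent: "\<phi>' x * (y - x) \<le> \<phi> y - \<phi> x" if "x \<in> I" "y \<in> I" for x y
  proof (rule convex_on_imp_above_tangent[OF conv])
    show "connected I" using convex_on_imp_convex[OF conv] by (rule convex_connected)
    show "x \<in> interior I" using that I by (simp add: interior_open)
    show "(\<phi> has_real_derivative \<phi>' x) (at x within I)"
      using d1[OF that(1)] by (rule has_field_derivative_at_within)
  qed (rule that)
  have "\<phi>' t * (s - t) + \<phi>' s * (t - s) \<le> 0"
    using tangent[OF I(2) s(1)] tangent[OF s(1) I(2)] by linarith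
  then have "(\<phi>' t - \<phi>' s) * (s - t) \<le> 0" by (simp add: algebra_simps)
  then show False using s by (simp add: mult_le_0_iff)
qed

theorem theorem4p4:
  fixes M :: "'a topology" and A :: "('a, 'm::finite) chart set"
    and g :: "'a \<Rightarrow> ('a, 'm) tvec \<Rightarrow> ('a, 'm) tvec \<Rightarrow> real"
    and nabla :: "'a \<Rightarrow> ('a, 'm) tvec \<Rightarrow> ('a, 'm) vfield \<Rightarrow> ('a, 'm) tvec"
    and k :: nat and \<Sigma> :: "'a \<Rightarrow> ('a, 'm) tvec set" and f :: "'a \<Rightarrow> real"
  assumes "sub_riemannian_manifold M A g nabla k \<Sigma>"
    and "smooth_manifold.smooth_fun A (topspace M) f"
  shows "sub_riemannian_manifold.n_convex M A g nabla \<Sigma> f \<longleftrightarrow>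
    (\<forall>p\<in>topspace M. \<forall>v\<in>\<Sigma> p. 0 \<le> sub_riemannian_manifold.hHess A g nabla \<Sigma> f p v v)"
proof -
  interpret sub_riemannian_manifold M A g nabla k \<Sigma> by (rule assms(1))
  note f = assms(2)
  note D1 = derivative_along_horizontal_curve[OF f geodesic_curves(2)]
  note D2 = second_derivative_along_geodesic[OF f]
  show ?thesis
  proof (intro iffI ballI)
    fix p v assume conv: "n_convex f" and p: "p \<in> topspace M" and v: "v \<in> \<Sigma> p"
    obtain I \<gamma> where \<gamma>: "nonholonomic_geodesic I \<gamma>" "0 \<in> I" "\<gamma> 0 = p" "velocity \<gamma> 0 = v"
      using geodesic_exists[OF p v] .
    have "0 \<le> hHess f (\<gamma> 0) (velocity \<gamma> 0) (velocity \<gamma> 0)"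
    proof (rule second_derivative_nonneg_of_convex_on[OF _ _ \<gamma>(2) D1[OF \<gamma>(1)] D2[OF \<gamma>(1,2)]])
      show "convex_on I (f \<circ> \<gamma>)" using conv \<gamma>(1) by (simp add: n_convex_def)
      show "open I" using geodesic_curves(1)[OF \<gamma>(1)] by (simp add: smooth_curve_def)
    qed
    then show "0 \<le> hHess f p v v" by (simp add: \<gamma>)
  next
    assume H: "\<forall>p\<in>topspace M. \<forall>v\<in>\<Sigma> p. 0 \<le> hHess f p v v"
    show "n_convex f"
      unfolding n_convex_def
    proof (intro allI impI)
      fix I \<gamma> assume \<gamma>: "nonholonomic_geodesic I \<gamma>"
      note sc = geodesic_curves(1)[OF \<gamma>]
      show "convex_on I (f \<circ> \<gamma>)"
      proof (rule f''_ge0_imp_convex[OF _ D1[OF \<gamma>] D2[OF \<gamma>]])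
        show "convex I" using sc is_interval_convex by (auto simp: smooth_curve_def)
        show "0 \<le> hHess f (\<gamma> t) (velocity \<gamma> t) (velocity \<gamma> t)" if "t \<in> I" for t
          using H curve_in_topspace[OF sc that]
            horizontal_curve_velocity[OF geodesic_curves(2)[OF \<gamma>] that] by blast
      qed
    qed
  qed
qed

end
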